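(* Let $\{D_1,\dots,D_m\}$ be a $(v,m,k,\lambda)$-SEDF in a finite abelian group $G$ of order $v$, let $D=\bigcup_{i=1}^mD_i$, and let $p$ be a prime dividing $v$, with $G_p$ the Sylow $p$-subgroup of $G$. Suppose $U$ is a subgroup of $G$ with $U\cap G_p=\{1\}$ and $p$ is self-conjugate modulo $\exp(G/U)$. Let $d$ be a nonnegative integer. (1) If $|\chi(D)|^2\equiv0\pmod{p^{2d}}$ for every nonprincipal $\chi\in\widehat{G}$, then $\exp(G_p)\le\max\Big\{\frac{|U|}{p^d}|G_p|,\ \frac{p\,|\widehat{G}^0|\cdot|U|}{(p-1)v}|G_p|\Big\}$. (2) If $|\chi(D_1)|^2\equiv0\pmod{p^{2d}}$ for every nonprincipal $\chi\in\widehat{G}$, then $\exp(G_p)\le\frac{|U|}{p^d}|G_p|$.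
   Context: Groups are finite abelian, written multiplicatively with identity $1$. For a subset $A\subseteq G$ we also write $A$ for $\sum_{a\in A}a\in\mathbb{Z}[G]$ and $A^{(-1)}=\sum_{a\in A}a^{-1}$. Given integers $m\ge 2$, $k\ge1$, $\lambda\ge 1$ and a group $G$ of order $v$, mutually disjoint $k$-subsets $D_1,\dots,D_m$ form a $(v,m,k,\lambda)$-SEDF in $G$ if $D_j\sum_{i\ne j}D_i^{(-1)}=\lambda(G-1)$ in $\mathbb{Z}[G]$ for each $j$. $\widehat{G}$ is the character group, characters extended linearly to $\mathbb{Z}[G]$; character values are algebraic integers and congruences are taken in the ring of algebraic integers. $\widehat{G}^0$ is the set of nonprincipal $\chi\in\widehat{G}$ with $\chi(D)=0$. A prime $q$ is self-conjugate modulo $n$ if there is an integer $j$ with $q^j\equiv-1\pmod{n_q}$, where $n_q$ is the largest divisor of $n$ not divisible by $q$. $\exp$ denotes the exponent of a group. *)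

theory Defs
  imports
    "HOL-Library.Poly_Mapping"
    "HOL-Algebra.Coset"
    "HOL-Library.Disjoint_Sets"
    "HOL-Computational_Algebra.Polynomial"
    "HOL-Number_Theory.Cong"
    Complex_Main
begin

text \<open>
  Elements of the integral group ring of \<open>G\<close> are elements of the free abelian group
  \<open>'a \<Rightarrow>\<^sub>0 int\<close> whose keys lie in \<open>carrier G\<close>; a group element \<open>a\<close> is identified with
  \<open>frag_of a\<close>. The additive structure is that of \<open>'a \<Rightarrow>\<^sub>0 int\<close>, and the multiplication is
  the bilinear extension of the multiplication of \<open>G\<close>.
\<close>

definition gr_mult :: "('a, 'b) monoid_scheme \<Rightarrow> ('a \<Rightarrow>\<^sub>0 int) \<Rightarrow> ('a \<Rightarrow>\<^sub>0 int) \<Rightarrow> ('a \<Rightarrow>\<^sub>0 int)"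
  where "gr_mult G x y = frag_extend (\<lambda>a. frag_extend (\<lambda>b. frag_of (a \<otimes>\<^bsub>G\<^esub> b)) y) x"

definition gr_set :: "'a set \<Rightarrow> ('a \<Rightarrow>\<^sub>0 int)"
  where "gr_set A = (\<Sum>a\<in>A. frag_of a)"

definition gr_set_inv :: "('a, 'b) monoid_scheme \<Rightarrow> 'a set \<Rightarrow> ('a \<Rightarrow>\<^sub>0 int)"
  where "gr_set_inv G A = (\<Sum>a\<in>A. frag_of (inv\<^bsub>G\<^esub> a))"

definition SEDF ::
    "('a, 'b) monoid_scheme \<Rightarrow> nat \<Rightarrow> nat \<Rightarrow> nat \<Rightarrow> nat \<Rightarrow> (nat \<Rightarrow> 'a set) \<Rightarrow> bool"
  where "SEDF G v m k l D \<longleftrightarrow>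
    m \<ge> 2 \<and> k \<ge> 1 \<and> l \<ge> 1 \<and> Coset.order G = v \<and>
    (\<forall>i\<in>{1..m}. D i \<subseteq> carrier G \<and> card (D i) = k) \<and>
    disjoint_family_on D {1..m} \<and>
    (\<forall>j\<in>{1..m}.
       gr_mult G (gr_set (D j)) (\<Sum>i\<in>{1..m} - {j}. gr_set_inv G (D i)) =
       frag_cmul (int l) (gr_set (carrier G) - frag_of \<one>\<^bsub>G\<^esub>))"

definition complex_mult_group :: "complex monoid"
  where "complex_mult_group = \<lparr>carrier = - {0}, monoid.mult = (*), one = 1\<rparr>"

text \<open>
  Characters are taken \<open>extensional\<close>, so that distinct functions of type \<open>'a \<Rightarrow> complex\<close> are
  distinct characters; this matters when characters are counted.
\<close>

definition characters :: "('a, 'b) monoid_scheme \<Rightarrow> ('a \<Rightarrow> complex) set"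
  where "characters G = hom G complex_mult_group \<inter> extensional (carrier G)"

definition principal_character :: "('a, 'b) monoid_scheme \<Rightarrow> 'a \<Rightarrow> complex"
  where "principal_character G = (\<lambda>x\<in>carrier G. 1)"

definition char_extend :: "('a \<Rightarrow> complex) \<Rightarrow> ('a \<Rightarrow>\<^sub>0 int) \<Rightarrow> complex"
  where "char_extend \<chi> x =
    (\<Sum>a\<in>Poly_Mapping.keys x. of_int (Poly_Mapping.lookup x a) * \<chi> a)"

definition nonprincipal_zeros :: "('a, 'b) monoid_scheme \<Rightarrow> 'a set \<Rightarrow> ('a \<Rightarrow> complex) set"
  where "nonprincipal_zeros G A =
    {\<chi> \<in> characters G - {principal_character G}. char_extend \<chi> (gr_set A) = 0}"

text \<open>For algebraic integers \<open>a\<close>, \<open>b\<close>, \<open>n\<close>, this is congruence in the ring of algebraic integers.\<close>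

definition alg_int_cong :: "complex \<Rightarrow> complex \<Rightarrow> complex \<Rightarrow> bool"
  where "alg_int_cong a b n \<longleftrightarrow> (\<exists>c. algebraic_int c \<and> a - b = n * c)"

definition group_exponent :: "('a, 'b) monoid_scheme \<Rightarrow> nat"
  where "group_exponent G = (LEAST n. n > 0 \<and> (\<forall>x\<in>carrier G. x [^]\<^bsub>G\<^esub> n = \<one>\<^bsub>G\<^esub>))"

definition sylow_subgroup :: "nat \<Rightarrow> 'a set \<Rightarrow> ('a, 'b) monoid_scheme \<Rightarrow> bool"
  where "sylow_subgroup p P G \<longleftrightarrow> subgroup P G \<and> card P = p ^ multiplicity p (Coset.order G)"

definition largest_divisor_without :: "nat \<Rightarrow> nat \<Rightarrow> nat"
  where "largest_divisor_without q n = Max {t. t dvd n \<and> \<not> q dvd t}"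

text \<open>
  A prime \<open>q\<close> is a unit of finite order modulo \<open>largest_divisor_without q n\<close>, so natural
  exponents yield the same powers as integer ones.
\<close>

definition self_conjugate :: "nat \<Rightarrow> nat \<Rightarrow> bool"
  where "self_conjugate q n \<longleftrightarrow>
    (\<exists>j::nat. [int q ^ j = - 1] (mod int (largest_divisor_without q n)))"

end

theory Submission
imports
  "HOL-Number_Theory.Number_Theory"
  Defs
  "Jordan_Normal_Form.Char_Poly"
  "HOL-Computational_Algebra.Fundamental_Theorem_Algebra"
begin

text \<open>
  Let \<open>p\<^sup>s\<close> be the exponent of the Sylow subgroup \<open>P\<close>, let \<open>t \<in> P\<close> have order \<open>p\<^sup>s\<close>, let
  \<open>\<chi>\<close> be a character of \<open>G\<close> which is faithful on \<open>\<langle>t\<rangle>\<close>, let \<open>W\<close> be its kernel in \<open>P\<close>, and put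
  \<open>N = U W\<close>. Then \<open>G/N\<close> has the cyclic Sylow \<open>p\<close>-subgroup \<open>\<langle>N t\<rangle>\<close> of order \<open>p\<^sup>s\<close>, and
  \<open>|N| p\<^sup>s = |U| |P|\<close>. Let \<open>a\<close> count the elements of \<open>D\<close> (or \<open>D\<^sub>1\<close>) in the cosets of \<open>N\<close>, and
  let \<open>g\<close> be an element of order \<open>p\<close> in \<open>\<langle>N t\<rangle>\<close>. Self-conjugacy and a form of Ma's lemma give
  \<open>a x \<equiv> a (x g)\<close> modulo \<open>p\<^sup>d\<close>. Since \<open>0 \<le> a \<le> |N|\<close>, either \<open>p\<^sup>d \<le> |N|\<close>, which is the first
  bound, or \<open>a\<close> is invariant under \<open>g\<close>, so that all \<open>|G/N| (1 - 1/p)\<close> characters of \<open>G/N\<close> which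
  are nontrivial at \<open>g\<close> vanish on \<open>D\<close>, which gives the second bound; for \<open>D\<^sub>1\<close> this is impossible,
  because \<open>\<chi>(D\<^sub>1)\<close> divides \<open>-\<lambda> \<noteq> 0\<close>.

  Neither cyclotomic rings nor prime ideals are needed for the congruence. Write \<open>\<pi> = 1 - \<zeta>\<close> with
  \<open>\<zeta>\<close> the conjugate of \<open>\<chi>(t)\<close>. In the ring of all algebraic integers, a power of Frobenius
  takes the character sum of \<open>a\<close> to its conjugate modulo \<open>\<pi>\<close>, so if the norm of the sum is divisible by
  \<open>\<pi>\<close>, the sum is nilpotent modulo \<open>\<pi>\<close>. Its \<open>p\<close>-regular part is then nilpotent modulo \<open>p\<close>, and
  being fixed by a power of Frobenius it vanishes modulo \<open>p\<close>. Fourier inversion over the \<open>p\<close>-regular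
  characters turns this into \<open>a \<in> (1 - t) \<int>[G/N] + p \<int>[G/N]\<close>. Repeating this
  \<open>\<phi>(p\<^sup>s) = p\<^sup>s - p\<^sup>s\<^sup>-\<^sup>1\<close> times and multiplying by \<open>1 - g \<equiv> (1 - t)\<close> to the power \<open>p\<^sup>s\<^sup>-\<^sup>1\<close>
  yields \<open>(1 - g) a \<equiv> (1 - t)\<close> to the power \<open>p\<^sup>s\<close>, that is \<open>0\<close>, modulo \<open>p\<close>.
\<close>

section \<open>The ring of algebraic integers\<close>

text \<open>The equations make \<open>f\<close> a nonzero eigenvector of an integer matrix, so
  \<open>z\<close> is a root of the characteristic polynomial, which is monic with integer
  coefficients.\<close>

lemma algebraic_int_eigenvalue:
  fixes z :: complex and f :: "nat \<Rightarrow> complex" and c :: "nat \<Rightarrow> nat \<Rightarrow> int"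
  assumes eq: "\<And>i. i < n \<Longrightarrow> z * f i = (\<Sum>k<n. of_int (c i k) * f k)"
    and nz: "i0 < n" "f i0 \<noteq> 0"
  shows "algebraic_int z"
proof -
  define B :: "int mat" where "B = mat n n (\<lambda>(i, k). c i k)"
  define A :: "complex mat" where "A = map_mat of_int B"
  have B: "B \<in> carrier_mat n n" by (simp add: B_def)
  hence A: "A \<in> carrier_mat n n" by (simp add: A_def)
  have "A *\<^sub>v vec n f = z \<cdot>\<^sub>v vec n f"
    by (rule eq_vecI) (auto simp: A_def B_def scalar_prod_def eq atLeast0LessThan)
  moreover have "vec n f \<noteq> 0\<^sub>v n"
    using nz by (metis index_vec index_zero_vec(1))
  ultimately have "eigenvector A (vec n f) z"
    using A by (simp add: eigenvector_def)
  hence "poly (char_poly A) z = 0"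
    using eigenvalue_root_char_poly[OF A] by (auto simp: eigenvalue_def)
  moreover have "char_poly A = map_poly of_int (char_poly B)"
    unfolding A_def by (rule of_int_hom.char_poly_hom[OF B])
  moreover have "lead_coeff (char_poly B) = 1"
    using degree_monic_char_poly[OF B] by simp
  ultimately show ?thesis
    unfolding algebraic_int_altdef_ipoly by auto
qed

text \<open>The same criterion by renumbering; sums and products below are indexed by pairs.\<close>

lemma algebraic_int_eigenvalue_family:
  fixes z :: complex and f :: "'i \<Rightarrow> complex" and c :: "'i \<Rightarrow> 'i \<Rightarrow> int"
  assumes "finite I" and eq: "\<And>i. i \<in> I \<Longrightarrow> z * f i = (\<Sum>k\<in>I. of_int (c i k) * f k)"
    and nz: "i0 \<in> I" "f i0 \<noteq> 0"
  shows "algebraic_int z"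
proof -
  obtain h where h: "bij_betw h {..<card I} I"
    using ex_bij_betw_nat_finite[OF \<open>finite I\<close>] by (auto simp: atLeast0LessThan)
  obtain i where i: "i < card I" "h i = i0"
    using h nz(1) unfolding bij_betw_def by (metis imageE lessThan_iff)
  show ?thesis
  proof (rule algebraic_int_eigenvalue[of "card I" z "\<lambda>i. f (h i)" "\<lambda>i k. c (h i) (h k)" i])
    fix i assume "i < card I"
    hence "h i \<in> I" using h by (auto simp: bij_betw_def)
    from eq[OF this] show "z * f (h i) = (\<Sum>k<card I. of_int (c (h i) (h k)) * f (h k))"
      by (simp add: sum.reindex_bij_betw[OF h, of "\<lambda>k. of_int (c (h i) k) * f k"])
  qed (use i nz in auto)
qed

text \<open>The powers of \<open>x\<close> below the degree of a monic integer polynomial span a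
  module stable under multiplication by \<open>x\<close>; \<open>c\<close> is the companion
  matrix.\<close>

lemma algebraic_int_power_basis:
  fixes x :: complex
  assumes "algebraic_int x"
  obtains n and c :: "nat \<Rightarrow> nat \<Rightarrow> int"
  where "n > 0" "\<And>i. i < n \<Longrightarrow> x * x ^ i = (\<Sum>k<n. of_int (c i k) * x ^ k)"
proof -
  obtain q where q: "poly (map_poly of_int q) x = 0" "lead_coeff q = 1"
    using assms unfolding algebraic_int_altdef_ipoly by auto
  define n where "n = degree q"
  have deg: "degree (map_poly of_int q :: complex poly) = n" by (simp add: n_def)
  have n0: "n > 0"
  proof (rule ccontr)
    assume "\<not> n > 0"
    then obtain a where "q = [:a:]" unfolding n_def by (metis degree_eq_zeroE neq0_conv)
    with q show False by auto
  qed
  have "0 = (\<Sum>k\<le>n. of_int (coeff q k) * x ^ k)"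
    using q(1) unfolding poly_altdef deg by (simp add: coeff_map_poly)
  also have "\<dots> = (\<Sum>k<n. of_int (coeff q k) * x ^ k) + x ^ n"
    using q(2) by (simp add: lessThan_Suc_atMost[symmetric] n_def)
  finally have top: "x ^ n = (\<Sum>k<n. of_int (- coeff q k) * x ^ k)"
    by (simp add: sum_negf add_eq_0_iff)
  define c where "c = (\<lambda>i k. if Suc i < n then (if k = Suc i then 1 else 0) else - coeff q k)"
  have "x * x ^ i = (\<Sum>k<n. of_int (c i k) * x ^ k)" if "i < n" for i
  proof (cases "Suc i < n")
    case True
    have "(\<Sum>k<n. of_int (c i k) * x ^ k) = (\<Sum>k<n. if k = Suc i then x ^ k else 0)"
      using True by (intro sum.cong) (auto simp: c_def)
    also have "\<dots> = x ^ Suc i" using True by (simp add: sum.delta)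
    finally show ?thesis by simp
  next
    case False
    hence "n = Suc i" using that by simp
    with top False show ?thesis by (simp add: c_def)
  qed
  with n0 that show ?thesis by blast
qed

text \<open>The monomials \<open>x ^ i * y ^ j\<close> span a finitely generated module stable under
  multiplication by \<open>x\<close> and by \<open>y\<close>. It contains 1, at index
  \<open>(0, 0)\<close>, which makes the eigenvector nonzero.\<close>

lemma
  fixes x y :: complex
  assumes "algebraic_int x" "algebraic_int y"
  shows algebraic_int_add: "algebraic_int (x + y)"
    and algebraic_int_mult: "algebraic_int (x * y)"
proof -
  obtain m c where m: "m > 0" and c: "\<And>i. i < m \<Longrightarrow> x * x ^ i = (\<Sum>k<m. of_int (c i k) * x ^ k)"
    using algebraic_int_power_basis[OF assms(1)] by blast
  obtain n d where n: "n > 0" and d: "\<And>i. i < n \<Longrightarrow> y * y ^ i = (\<Sum>k<n. of_int (d i k) * y ^ k)"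
    using algebraic_int_power_basis[OF assms(2)] by blast
  let ?I = "{..<m} \<times> {..<n}"
  let ?f = "\<lambda>(i, j). x ^ i * y ^ j"
  show "algebraic_int (x * y)"
  proof (rule algebraic_int_eigenvalue_family[of ?I _ ?f "\<lambda>(i, j) (k, l). c i k * d j l" "(0, 0)"])
    fix ij assume "ij \<in> ?I"
    then obtain i j where ij: "ij = (i, j)" "i < m" "j < n" by auto
    have "x * y * (x ^ i * y ^ j) = (x * x ^ i) * (y * y ^ j)" by (simp add: algebra_simps)
    also have "\<dots> = (\<Sum>k<m. \<Sum>l<n. of_int (c i k) * x ^ k * (of_int (d j l) * y ^ l))"
      by (simp only: c[OF ij(2)] d[OF ij(3)] sum_product)
    finally show "x * y * ?f ij =
        (\<Sum>kl\<in>?I. of_int ((\<lambda>(i, j) (k, l). c i k * d j l) ij kl) * ?f kl)"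
      by (simp add: ij(1) sum.cartesian_product split_beta mult_ac)
  qed (use m n in auto)
  show "algebraic_int (x + y)"
  \<comment> \<open>For the product the matrix is the Kronecker product of \<open>c\<close> and
    \<open>d\<close>; here each matrix acts on its own index and the identity on the other.\<close>
  proof (rule algebraic_int_eigenvalue_family[of ?I _ ?f
        "\<lambda>ij kl. (if snd kl = snd ij then c (fst ij) (fst kl) else 0)
           + (if fst kl = fst ij then d (snd ij) (snd kl) else 0)" "(0, 0)"])
    fix ij assume "ij \<in> ?I"
    then obtain i j where ij: "ij = (i, j)" "i < m" "j < n" by auto
    have 1: "(\<Sum>k<m. \<Sum>l<n. of_int (if l = j then c i k else 0) * (x ^ k * y ^ l))
        = x * x ^ i * y ^ j"
    proof -
      have "(\<Sum>l<n. of_int (if l = j then c i k else 0) * (x ^ k * y ^ l))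
          = of_int (c i k) * x ^ k * y ^ j" for k
        using ij(3) by (subst sum.mono_neutral_right[of _ "{j}"]) auto
      thus ?thesis by (simp add: c[OF ij(2)] sum_distrib_right)
    qed
    have 2: "(\<Sum>k<m. \<Sum>l<n. of_int (if k = i then d j l else 0) * (x ^ k * y ^ l))
        = x ^ i * (y * y ^ j)"
    proof -
      have "(\<Sum>l<n. of_int (if k = i then d j l else 0) * (x ^ k * y ^ l))
          = (if k = i then x ^ i * (y * y ^ j) else 0)" for k
        by (auto simp: d[OF ij(3)] sum_distrib_left mult_ac)
      thus ?thesis using ij(2) by simp
    qed
    have "(x + y) * (x ^ i * y ^ j) = x * x ^ i * y ^ j + x ^ i * (y * y ^ j)"
      by (simp add: algebra_simps)
    also have "\<dots> = (\<Sum>k<m. \<Sum>l<n.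
        of_int ((if l = j then c i k else 0) + (if k = i then d j l else 0)) * (x ^ k * y ^ l))"
      by (simp only: 1[symmetric] 2[symmetric] of_int_add distrib_right sum.distrib)
    finally show "(x + y) * ?f ij = (\<Sum>kl\<in>?I. of_int (
        (if snd kl = snd ij then c (fst ij) (fst kl) else 0)
        + (if fst kl = fst ij then d (snd ij) (snd kl) else 0)) * ?f kl)"
      unfolding ij(1) fst_conv snd_conv by (simp add: sum.cartesian_product split_beta)
  qed (use m n in auto)
qed

lemma algebraic_int_diff: "algebraic_int (x :: complex) \<Longrightarrow> algebraic_int y \<Longrightarrow> algebraic_int (x - y)"
  using algebraic_int_add[of x "- y"] by simp

lemma algebraic_int_sum: "(\<And>i. i \<in> A \<Longrightarrow> algebraic_int (f i :: complex)) \<Longrightarrow> algebraic_int (sum f A)"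
  by (induction A rule: infinite_finite_induct) (auto intro: algebraic_int_add)

lemma algebraic_int_prod: "(\<And>i. i \<in> A \<Longrightarrow> algebraic_int (f i :: complex)) \<Longrightarrow> algebraic_int (prod f A)"
  by (induction A rule: infinite_finite_induct) (auto intro: algebraic_int_mult)

lemma algebraic_int_power: "algebraic_int (x :: complex) \<Longrightarrow> algebraic_int (x ^ n)"
  by (induction n) (auto intro: algebraic_int_mult)

lemma lead_coeff_unity_poly:
  "n > 0 \<Longrightarrow> lead_coeff (Polynomial.monom 1 n - 1 :: 'a :: idom poly) = 1"
  using lead_coeff_add_le[of "- 1 :: 'a poly" "Polynomial.monom 1 n"] by (simp add: degree_monom_eq)

lemma algebraic_int_root_unity:
  assumes "(z :: complex) ^ n = 1" "n > 0"
  shows "algebraic_int z"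
proof (rule algebraic_int.intros[of "Polynomial.monom 1 n - 1"])
  show "lead_coeff (Polynomial.monom (1::complex) n - 1) = 1"
    using assms(2) by (rule lead_coeff_unity_poly)
qed (use assms in \<open>auto simp: poly_monom coeff_diff coeff_monom\<close>)

lemmas algebraic_int_intros = algebraic_int_add algebraic_int_diff algebraic_int_mult
  algebraic_int_power algebraic_int_sum algebraic_int_prod algebraic_int_of_int algebraic_int_of_nat

section \<open>Divisibility and congruence among algebraic integers\<close>

text \<open>This is \<open>alg_int_cong a 0 n\<close>. Only the quotient has to be an algebraic
  integer, so many rules need no side conditions; congruences are written as divisibility of a
  difference.\<close>

definition alg_dvd :: "complex \<Rightarrow> complex \<Rightarrow> bool" (infix \<open>advd\<close> 50)
  where "n advd a \<longleftrightarrow> (\<exists>c. algebraic_int c \<and> a = n * c)"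

lemma advdI: "algebraic_int c \<Longrightarrow> a = n * c \<Longrightarrow> n advd a"
  by (auto simp: alg_dvd_def)

lemma advd_0 [simp]: "n advd 0"
  by (rule advdI[of 0]) auto

lemma advd_refl: "n advd n"
  by (rule advdI[of 1]) auto

lemma advd_mult: "n advd a \<Longrightarrow> algebraic_int b \<Longrightarrow> n advd a * b"
  unfolding alg_dvd_def by (metis algebraic_int_mult mult.assoc)

lemma advd_mult': "n advd a \<Longrightarrow> algebraic_int b \<Longrightarrow> n advd b * a"
  using advd_mult[of n a b] by (simp add: mult.commute)

lemma advd_add: "n advd a \<Longrightarrow> n advd b \<Longrightarrow> n advd a + b"
  unfolding alg_dvd_def by (metis algebraic_int_add distrib_left)

lemma advd_minus: "n advd a \<Longrightarrow> n advd - a"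
  unfolding alg_dvd_def by (metis algebraic_int_minus mult_minus_right)

lemma advd_diff: "n advd a \<Longrightarrow> n advd b \<Longrightarrow> n advd a - b"
  using advd_add[of n a "- b"] advd_minus[of n b] by simp

lemma advd_sum: "(\<And>i. i \<in> A \<Longrightarrow> n advd f i) \<Longrightarrow> n advd sum f A"
  by (induction A rule: infinite_finite_induct) (auto intro: advd_add)

lemma advd_trans: "n advd m \<Longrightarrow> m advd a \<Longrightarrow> n advd a"
  unfolding alg_dvd_def by (metis algebraic_int_mult mult.assoc)

lemma advd_cong_trans: "n advd a - b \<Longrightarrow> n advd b - c \<Longrightarrow> n advd a - c"
  using advd_add[of n "a - b" "b - c"] by simp

lemma advd_cong_sym: "n advd a - b \<Longrightarrow> n advd b - a"
  using advd_minus[of n "a - b"] by simp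

lemma advd_cong_0: "n advd a - b \<Longrightarrow> n advd a \<Longrightarrow> n advd b"
  using advd_diff[of n a "a - b"] by simp

lemma advd_power: "n advd a \<Longrightarrow> n ^ k advd a ^ k"
  unfolding alg_dvd_def by (metis algebraic_int_power power_mult_distrib)

lemma advd_cong_power:
  assumes "n advd a - b" "algebraic_int a" "algebraic_int b"
  shows "n advd a ^ k - b ^ k"
  unfolding power_diff_sumr2 using assms by (intro advd_mult algebraic_int_intros)

lemma advd_power_gt_0: "n advd a \<Longrightarrow> algebraic_int a \<Longrightarrow> k > 0 \<Longrightarrow> n advd a ^ k"
  by (cases k) (auto intro!: advd_mult algebraic_int_power)

text \<open>A rational algebraic integer is an integer. This brings congruences of character sums
  back to congruences of integers.\<close>

lemma of_int_advd_of_int_iff: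
  "(of_int n :: complex) advd of_int a \<longleftrightarrow> n dvd a"
proof
  assume "of_int n advd (of_int a)"
  then obtain c where c: "algebraic_int c" "of_int a = of_int n * (c :: complex)"
    by (auto simp: alg_dvd_def)
  show "n dvd a"
  proof (cases "n = 0")
    case False
    hence "c = of_int a / of_int n" using c(2) by (simp add: field_simps)
    hence "c \<in> \<rat>" by simp
    with c(1) have "c \<in> \<int>" by (rule rational_algebraic_int_is_int)
    then obtain m where "c = of_int m" by (auto elim: Ints_cases)
    hence "of_int a = (of_int (n * m) :: complex)" using c(2) by simp
    thus ?thesis by (simp only: of_int_eq_iff dvd_triv_left)
  qed (use c in auto)
next
  assume "n dvd a"
  then obtain c where "a = n * c" by (elim dvdE)
  thus "of_int n advd (of_int a)" by (intro advdI[of "of_int c"]) auto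
qed

section \<open>The Frobenius map modulo \<open>p\<close>\<close>

text \<open>By absorption, \<open>p ^ k\<close> divides \<open>i * (p ^ k choose i)\<close>; if the
  binomial coefficient were prime to \<open>p\<close>, then \<open>p ^ k\<close> would divide the
  smaller number \<open>i\<close>.\<close>

lemma prime_dvd_choose_prime_power:
  assumes "prime (p :: nat)" "0 < i" "i < p ^ k"
  shows "p dvd (p ^ k choose i)"
proof (rule ccontr)
  assume "\<not> p dvd (p ^ k choose i)"
  hence "coprime (p ^ k) (p ^ k choose i)"
    using assms(1) by (simp add: prime_imp_coprime)
  moreover have "p ^ k dvd i * (p ^ k choose i)"
    using times_binomial_minus1_eq[OF assms(2), of "p ^ k"] by simp
  ultimately have "p ^ k dvd i" by (simp add: coprime_dvd_mult_left_iff)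
  with assms show False by (auto dest: dvd_imp_le)
qed

lemma advd_add_prime_power:
  assumes p: "prime p" and xy: "algebraic_int x" "algebraic_int y"
  shows "of_nat p advd (x + y) ^ (p ^ k) - (x ^ (p ^ k) + y ^ (p ^ k))"
proof -
  let ?q = "p ^ k" and ?f = "\<lambda>i. of_nat (p ^ k choose i) * x ^ i * y ^ (p ^ k - i)"
  have q: "?q > 0" using p by (simp add: prime_gt_0_nat)
  have "{..?q} = insert 0 (insert ?q {0<..<?q})" using q by auto
  hence "(x + y) ^ ?q = x ^ ?q + y ^ ?q + (\<Sum>i\<in>{0<..<?q}. ?f i)"
    unfolding binomial_ring using q by simp
  moreover have "of_nat p advd ?f i" if "i \<in> {0<..<?q}" for i
  proof -
    from prime_dvd_choose_prime_power[OF p] that obtain c where "?q choose i = p * c"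
      by (metis dvdE greaterThanLessThan_iff)
    thus ?thesis using xy
      by (intro advdI[of "of_nat c * x ^ i * y ^ (?q - i)"]) (auto intro!: algebraic_int_intros)
  qed
  ultimately show ?thesis using advd_sum[of "{0<..<?q}" "of_nat p" ?f] by simp
qed

text \<open>Fermat's little theorem, iterated. It lets Frobenius fix integer coefficients, and with
  \<open>a = - 1\<close> it handles the sign of \<open>(- 1) ^ (p ^ k)\<close> uniformly, including
  \<open>p = 2\<close>.\<close>

lemma prime_dvd_power_diff_self:
  assumes "prime p"
  shows "int p dvd a ^ (p ^ k) - a"
proof (induction k)
  case (Suc k)
  have "int p dvd b ^ p - b" for b
  proof (cases "int p dvd b")
    case False
    define c where "c = nat (b mod int p)"
    have c: "[b = int c] (mod int p)"
      using assms prime_gt_0_nat[of p] by (simp add: c_def cong_def)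
    with False have "\<not> p dvd c" by (metis cong_dvd_iff int_dvd_int_iff)
    hence "[c ^ (p - 1) = 1] (mod p)" using assms by (intro fermat_theorem)
    hence "[int (c ^ (p - 1)) = int 1] (mod int p)" by (simp only: cong_int_iff)
    hence "[b ^ (p - 1) = 1] (mod int p)"
      using cong_pow[OF c, of "p - 1"] by (auto intro: cong_trans)
    hence "[b * b ^ (p - 1) = b * 1] (mod int p)" by (rule cong_scalar_left)
    moreover have "b * b ^ (p - 1) = b ^ p"
      using assms prime_gt_0_nat[of p] by (simp flip: power_Suc)
    ultimately show ?thesis by (simp add: cong_iff_dvd_diff)
  next
    case True
    thus ?thesis using prime_gt_0_nat[OF assms] by (intro dvd_diff) (auto simp: dvd_power_le intro: dvd_trans)
  qed
  from dvd_add[OF this[of "a ^ (p ^ k)"] Suc] show ?case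
    by (simp add: power_mult[symmetric] mult.commute)
qed simp

text \<open>Frobenius is additive modulo \<open>p\<close> and fixes the integers \<open>a i\<close>,
  so it acts on an integral combination through the \<open>z i\<close> alone.\<close>

lemma advd_sum_prime_power:
  fixes z :: "'i \<Rightarrow> complex"
  assumes p: "prime p" and "finite A" and z: "\<And>i. i \<in> A \<Longrightarrow> algebraic_int (z i)"
  shows "of_nat p advd (\<Sum>i\<in>A. of_int (a i) * z i) ^ (p ^ k) - (\<Sum>i\<in>A. of_int (a i) * z i ^ (p ^ k))"
  using assms(2) z
proof (induction A rule: finite_induct)
  case empty
  have "p ^ k \<noteq> 0" using prime_gt_0_nat[OF p] by simp
  hence "(0 :: complex) ^ (p ^ k) = 0" by (simp only: power_0_left if_False)
  thus ?case by (simp only: sum.empty) simp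
next
  case (insert i A)
  let ?S = "\<Sum>i\<in>A. of_int (a i) * z i" and ?q = "p ^ k"
  have 1: "of_nat p advd (of_int (a i) * z i + ?S) ^ ?q - ((of_int (a i) * z i) ^ ?q + ?S ^ ?q)"
    using insert.prems by (intro advd_add_prime_power p algebraic_int_intros) auto
  have "of_int (int p) advd of_int (a i ^ ?q - a i)"
    unfolding of_int_advd_of_int_iff by (rule prime_dvd_power_diff_self[OF p])
  hence "of_nat p advd (of_int (a i ^ ?q - a i)) * z i ^ ?q"
    using insert.prems by (intro advd_mult algebraic_int_intros) auto
  from advd_add[OF advd_add[OF 1 this] insert.IH] insert show ?case
    by (simp add: algebra_simps power_mult_distrib)
qed

section \<open>Roots of unity of prime power order\<close>

lemma power_gcd_eq_1:
  fixes z :: "'a :: field"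
  assumes "z ^ a = 1" "z ^ b = 1"
  shows "z ^ gcd a b = 1"
proof (cases "a = 0")
  case False
  then obtain x y where "a * x = b * y + gcd a b" using bezout_nat by blast
  hence "z ^ (a * x) = z ^ (b * y) * z ^ gcd a b" by (simp add: power_add)
  thus ?thesis by (simp add: power_mult assms)
qed (use assms in simp)

text \<open>Otherwise \<open>z\<close> is killed by \<open>gcd k (p ^ s)\<close>, a proper power of
  \<open>p\<close> below \<open>p ^ s\<close>, hence already by \<open>p ^ (s - 1)\<close>.\<close>

lemma primitive_root_prime_power:
  fixes z :: "'a :: field"
  assumes p: "prime p" and z: "z ^ (p ^ s) = 1" "z ^ (p ^ (s - 1)) \<noteq> 1" and k: "0 < k" "k < p ^ s"
  shows "z ^ k \<noteq> 1"
proof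
  assume "z ^ k = 1"
  with z have 1: "z ^ gcd k (p ^ s) = 1" by (intro power_gcd_eq_1)
  obtain i where i: "i \<le> s" "gcd k (p ^ s) = p ^ i"
    using divides_primepow_nat[OF p] by (metis gcd_dvd2)
  have "gcd k (p ^ s) \<le> k" using k by (intro gcd_le1_nat) auto
  hence "i \<noteq> s" using i k by auto
  hence "p ^ (s - 1) = p ^ i * p ^ (s - 1 - i)" using i by (simp flip: power_add)
  hence "z ^ (p ^ (s - 1)) = 1" using 1 i by (simp add: power_mult)
  with z show False by simp
qed

lemma powers_primitive_root:
  fixes z :: complex
  assumes n: "n > 0" and z: "z ^ n = 1" and prim: "\<And>k. 0 < k \<Longrightarrow> k < n \<Longrightarrow> z ^ k \<noteq> 1"
  shows "inj_on (\<lambda>k. z ^ k) {..<n}" and "(\<lambda>k. z ^ k) ` {..<n} = {w. w ^ n = 1}"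
proof -
  have z0: "z \<noteq> 0" using n z by (auto simp: power_0_left)
  show inj: "inj_on (\<lambda>k. z ^ k) {..<n}"
  proof (rule linorder_inj_onI)
    fix i j assume ij: "i < j" "i \<in> {..<n}" "j \<in> {..<n}"
    have "z ^ (j - i) \<noteq> 1" using ij by (intro prim) auto
    thus "z ^ i \<noteq> z ^ j" using z0 ij by (simp add: power_diff)
  qed auto
  show "(\<lambda>k. z ^ k) ` {..<n} = {w. w ^ n = 1}"
  proof (rule card_subset_eq)
    show "finite {w :: complex. w ^ n = 1}" using n by (intro finite_roots_unity) auto
    show "(\<lambda>k. z ^ k) ` {..<n} \<subseteq> {w. w ^ n = 1}"
      using z by (auto simp: power_mult[symmetric] mult.commute[of _ n]) (simp add: power_mult)
    show "card ((\<lambda>k. z ^ k) ` {..<n}) = card {w :: complex. w ^ n = 1}"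
      using n by (simp add: card_image[OF inj] card_roots_unity_eq)
  qed
qed

text \<open>Cancel the factor \<open>X - 1\<close> from the factorisation of
  \<open>X ^ n - 1\<close> over the powers of \<open>z\<close>, and evaluate the remaining geometric
  sum at 1.\<close>

lemma prod_one_minus_primitive_root:
  fixes z :: complex
  assumes n: "n > 0" and z: "z ^ n = 1" and prim: "\<And>k. 0 < k \<Longrightarrow> k < n \<Longrightarrow> z ^ k \<noteq> 1"
  shows "(\<Prod>k\<in>{0<..<n}. 1 - z ^ k) = of_nat n"
proof -
  have bij: "bij_betw (\<lambda>k. z ^ k) {..<n} {w. w ^ n = 1}"
    using powers_primitive_root[OF assms] by (simp add: bij_betw_def)
  define f :: "complex poly" where "f = Polynomial.monom 1 n - 1"
  have pf: "poly f w = w ^ n - 1" for w by (simp add: f_def poly_monom)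
  have lf: "lead_coeff f = 1"
    unfolding f_def using n by (rule lead_coeff_unity_poly)
  have "rsquarefree f"
    unfolding rsquarefree_roots pf using n
    by (auto simp: f_def pderiv_diff pderiv_monom poly_monom pderiv_1 power_0_left)
  from complex_poly_decompose_rsquarefree[OF this] lf
  have "f = (\<Prod>w | w ^ n = 1. [:- w, 1:])" by (simp add: pf)
  also have "\<dots> = (\<Prod>k<n. [:- (z ^ k), 1:])"
    by (rule prod.reindex_bij_betw[OF bij, symmetric])
  also have "{..<n} = insert 0 {0<..<n}" using n by auto
  finally have f1: "f = [:- 1, 1:] * (\<Prod>k\<in>{0<..<n}. [:- (z ^ k), 1:])" by simp
  have f2: "f = [:- 1, 1:] * (\<Sum>k<n. Polynomial.monom 1 k)"
    by (rule poly_ext)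
      (use power_diff_1_eq[of _ n] in
        \<open>simp add: pf poly_sum poly_monom lessThan_atLeast0 mult.commute algebra_simps\<close>)
  have "(\<Prod>k\<in>{0<..<n}. [:- (z ^ k), 1:]) = (\<Sum>k<n. Polynomial.monom 1 k)"
    using f1 f2 by (metis mult_left_cancel pCons_eq_0_iff zero_neq_one)
  from arg_cong[OF this, of "\<lambda>q. poly q 1"] show ?thesis
    by (simp add: poly_prod poly_sum poly_monom)
qed

lemma one_minus_advd_one_minus_power:
  "algebraic_int z \<Longrightarrow> 1 - z advd 1 - z ^ k"
  unfolding one_diff_power_eq by (intro advdI[OF _ refl] algebraic_int_intros)

text \<open>The products of \<open>1 - z ^ k\<close> over all \<open>k\<close> and over the
  multiples of \<open>p\<close> are \<open>p ^ s\<close> and \<open>p ^ (s - 1)\<close>, so the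
  factors with \<open>k\<close> prime to \<open>p\<close> multiply to \<open>p\<close>. Their number
  is the exponent, and each is a multiple of \<open>1 - z\<close>.\<close>

lemma power_one_minus_root_advd_prime:
  fixes z :: complex
  assumes p: "prime p" and s: "s > 0" and z: "z ^ (p ^ s) = 1" "z ^ (p ^ (s - 1)) \<noteq> 1"
  shows "(1 - z) ^ (p ^ s - p ^ (s - 1)) advd of_nat p"
proof -
  let ?I = "{k \<in> {0<..<p ^ s}. \<not> p dvd k}"
  have p0: "p > 0" using p by (rule prime_gt_0_nat)
  have prim: "\<And>k. 0 < k \<Longrightarrow> k < p ^ s \<Longrightarrow> z ^ k \<noteq> 1"
    using primitive_root_prime_power[OF p z] .
  have ps: "p ^ s = p * p ^ (s - 1)" using s by (cases s) auto
  have split: "{0<..<p ^ s} = (\<lambda>k. p * k) ` {0<..<p ^ (s - 1)} \<union> ?I"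
    using p0 by (auto simp: ps elim!: dvdE)
  have inj: "inj_on (\<lambda>k. p * k) {0<..<p ^ (s - 1)}" using p0 by (auto intro: inj_onI)
  have disj: "(\<lambda>k. p * k) ` {0<..<p ^ (s - 1)} \<inter> ?I = {}" by auto
  have "(\<Prod>k\<in>{0<..<p ^ (s - 1)}. 1 - (z ^ p) ^ k) = of_nat (p ^ (s - 1))"
  proof (rule prod_one_minus_primitive_root)
    show "(z ^ p) ^ (p ^ (s - 1)) = 1" using z(1) by (simp add: ps power_mult)
    show "(z ^ p) ^ k \<noteq> 1" if "0 < k" "k < p ^ (s - 1)" for k
      using prim[of "p * k"] that p0 by (simp add: ps power_mult)
  qed (use p0 in simp)
  moreover have "(\<Prod>k\<in>{0<..<p ^ s}. 1 - z ^ k) = of_nat (p ^ s)"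
    using prim z(1) p0 by (intro prod_one_minus_primitive_root) auto
  ultimately have "of_nat (p ^ (s - 1)) * (\<Prod>k\<in>?I. 1 - z ^ k) = of_nat (p ^ s)"
    using arg_cong[OF split, of "\<lambda>A. \<Prod>k\<in>A. 1 - z ^ k"]
      prod.union_disjoint[OF _ _ disj, of "\<lambda>k. 1 - z ^ k"] inj
    by (simp add: prod.reindex power_mult)
  hence "(\<Prod>k\<in>?I. 1 - z ^ k) = of_nat p" using p0 by (simp add: ps)
  moreover have "(\<Prod>k\<in>?I. 1 - z ^ k) = (1 - z) ^ card ?I * (\<Prod>k\<in>?I. \<Sum>i<k. z ^ i)"
    unfolding one_diff_power_eq by (simp add: prod.distrib)
  moreover have "card ?I = p ^ s - p ^ (s - 1)"
  proof -
    have "card {0<..<p ^ s} = card {0<..<p ^ (s - 1)} + card ?I"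
      by (subst split, subst card_Un_disjoint[OF _ _ disj]) (simp_all only: card_image[OF inj] finite_imageI finite_greaterThanLessThan, auto)
    moreover have "p ^ s > 0" "p ^ (s - 1) > 0" using p0 by auto
    ultimately show ?thesis unfolding card_greaterThanLessThan by linarith
  qed
  moreover have "algebraic_int z" using z(1) p0 by (auto intro: algebraic_int_root_unity)
  ultimately show ?thesis
    by (intro advdI[of "\<Prod>k\<in>?I. \<Sum>i<k. z ^ i"] algebraic_int_intros) auto
qed

text \<open>By Frobenius the power is congruent to \<open>1 - z ^ (p ^ s)\<close>, which is
  0.\<close>

lemma advd_one_minus_root_power:
  fixes z :: complex
  assumes p: "prime p" and z: "z ^ (p ^ s) = 1"
  shows "of_nat p advd (1 - z) ^ (p ^ s)"
proof -
  have "p > 0" using p by (rule prime_gt_0_nat)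
  hence az: "algebraic_int z" using z(1) by (auto intro: algebraic_int_root_unity)
  have "of_nat p advd (1 - z) ^ (p ^ s) - (1 + (- z) ^ (p ^ s))"
    using advd_add_prime_power[OF p, of 1 "- z" s] az by simp
  moreover have "of_nat p advd 1 + (- z) ^ (p ^ s)"
  proof -
    have "of_int (int p) advd of_int ((- 1) ^ (p ^ s) - (- 1))"
      unfolding of_int_advd_of_int_iff by (rule prime_dvd_power_diff_self[OF p])
    thus ?thesis using z by (simp add: power_minus[of z] add.commute)
  qed
  ultimately show ?thesis using advd_add by fastforce
qed

section \<open>Characters of finite abelian groups\<close>

locale finite_comm_group = comm_group G for G (structure) +
  assumes fin: "finite (carrier G)"
begin

lemma order_pos: "Coset.order G > 0"
  using fin order_gt_0_iff_finite by blast

lemma ord_eq_prime_power: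
  assumes p: "prime p" and t: "t \<in> carrier G" "t [^] (p ^ s) = \<one>" "t [^] (p ^ (s - 1)) \<noteq> \<one>"
  shows "ord t = p ^ s"
proof -
  have "ord t dvd p ^ s" using t by (simp add: pow_eq_id)
  then obtain i where i: "i \<le> s" "ord t = p ^ i" using divides_primepow_nat[OF p] by blast
  have "i = s"
  proof (rule ccontr)
    assume "i \<noteq> s"
    hence "ord t dvd p ^ (s - 1)" using i by (simp add: le_imp_power_dvd)
    thus False using t by (simp add: pow_eq_id)
  qed
  with i show ?thesis by simp
qed

section \<open>Extension of characters from subgroups\<close>

text \<open>Nothing is asked of the values outside \<open>H\<close>; restriction to the carrier
  happens only once \<open>H\<close> has become the whole group.\<close>

definition partial_character :: "'a set \<Rightarrow> ('a \<Rightarrow> complex) \<Rightarrow> bool" where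
  "partial_character H \<phi> \<longleftrightarrow> subgroup H G \<and> (\<forall>x\<in>H. \<phi> x \<noteq> 0) \<and>
     (\<forall>x\<in>H. \<forall>y\<in>H. \<phi> (x \<otimes> y) = \<phi> x * \<phi> y)"

lemma partial_character_one:
  assumes "partial_character H \<phi>"
  shows "\<phi> \<one> = 1"
proof -
  have "\<one> \<in> H" using assms subgroup.one_closed by (auto simp: partial_character_def)
  hence "\<phi> (\<one> \<otimes> \<one>) = \<phi> \<one> * \<phi> \<one>" and "\<phi> \<one> \<noteq> 0"
    using assms unfolding partial_character_def by blast+
  thus ?thesis by simp
qed

lemma partial_character_pow:
  assumes "partial_character H \<phi>" "x \<in> H"
  shows "\<phi> (x [^] (n :: nat)) = \<phi> x ^ n"
proof -
  interpret H: subgroup H G using assms by (simp add: partial_character_def)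
  have "x [^] n \<in> H" for n :: nat using assms(2) by (induction n) auto
  thus ?thesis
    using assms by (induction n) (auto simp: partial_character_one partial_character_def)
qed

text \<open>Adjoin \<open>y\<close> to \<open>H\<close>. With \<open>r\<close> the least positive
  exponent bringing \<open>y\<close> into \<open>H\<close>, the only constraint on the new value
  \<open>w\<close> is \<open>w ^ r = \<phi> (y [^] r)\<close>; then
  \<open>h \<otimes> y [^] i\<close> is sent to \<open>\<phi> h * w ^ i\<close>.\<close>

lemma partial_character_extend:
  assumes pc: "partial_character H \<phi>" and y: "y \<in> carrier G"
    and r: "r > 0" "y [^] r \<in> H" "\<And>i::nat. 0 < i \<Longrightarrow> i < r \<Longrightarrow> y [^] i \<notin> H"
    and w: "w ^ r = \<phi> (y [^] r)"
  obtains H' \<phi>' where "partial_character H' \<phi>'" "H \<subseteq> H'" "y \<in> H'" "\<phi>' y = w"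
    "\<And>h. h \<in> H \<Longrightarrow> \<phi>' h = \<phi> h"
proof -
  interpret H: subgroup H G using pc by (simp add: partial_character_def)
  have \<phi>0: "\<phi> x \<noteq> 0" if "x \<in> H" for x using pc that by (simp add: partial_character_def)
  have \<phi>m: "\<phi> (x \<otimes> z) = \<phi> x * \<phi> z" if "x \<in> H" "z \<in> H" for x z
    using pc that by (simp add: partial_character_def)
  have w0: "w \<noteq> 0" using w r \<phi>0 by (auto simp: power_0_left)
  \<comment> \<open>Minimality of \<open>r\<close> forces \<open>r\<close> to divide every exponent
    \<open>i\<close> with \<open>y [^] i\<close> in \<open>H\<close>.\<close>
  have pow: "\<phi> (y [^] i) = w ^ i" if "y [^] i \<in> H" for i :: nat
  proof -
    have "y [^] (i div r * r + i mod r) = (y [^] r) [^] (i div r) \<otimes> y [^] (i mod r)"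
      using y by (simp only: nat_pow_mult[symmetric] nat_pow_pow mult.commute)
    hence "y [^] i = (y [^] r) [^] (i div r) \<otimes> y [^] (i mod r)" by simp
    moreover have yr: "(y [^] r) [^] k \<in> H" for k :: nat
      using r(2) by (induction k) auto
    ultimately have "y [^] (i mod r) = inv ((y [^] r) [^] (i div r)) \<otimes> y [^] i"
      using y by (simp add: inv_solve_left)
    hence "y [^] (i mod r) \<in> H" using that yr by simp
    hence "i mod r = 0" using r(1) r(3)[of "i mod r"] by (metis mod_less_divisor neq0_conv)
    then obtain k where k: "i = r * k" by auto
    hence "y [^] i = (y [^] r) [^] k" using y by (simp add: nat_pow_pow)
    thus ?thesis using partial_character_pow[OF pc r(2)] w k by (simp add: power_mult)
  qed
  have wd_le: "\<phi> h * w ^ i = \<phi> h' * w ^ j"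
    if "h \<in> H" "h' \<in> H" "h \<otimes> y [^] i = h' \<otimes> y [^] j" "i \<le> j" for h h' and i j :: nat
  proof -
    have "y [^] j = y [^] (j - i) \<otimes> y [^] i" using y that(4) by (simp add: nat_pow_mult)
    hence "h \<otimes> y [^] i = (h' \<otimes> y [^] (j - i)) \<otimes> y [^] i"
      using that y by (simp add: m_assoc)
    hence h: "h = h' \<otimes> y [^] (j - i)" using that y by simp
    hence "y [^] (j - i) = inv h' \<otimes> h" using that y by (simp add: inv_solve_left)
    hence "y [^] (j - i) \<in> H" using that by simp
    hence "\<phi> h = \<phi> h' * w ^ (j - i)" using h that by (simp add: \<phi>m pow)
    thus ?thesis using that(4) by (simp flip: power_add)
  qed
  have wd: "\<phi> h * w ^ i = \<phi> h' * w ^ j"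
    if "h \<in> H" "h' \<in> H" "h \<otimes> y [^] i = h' \<otimes> y [^] j" for h h' and i j :: nat
    using wd_le[OF that] wd_le[OF that(2,1) that(3)[symmetric]] by (cases "i \<le> j") auto
  define H' where "H' = {h \<otimes> y [^] i | h i. h \<in> H \<and> i \<in> (UNIV :: nat set)}"
  \<comment> \<open>The value is read off from an arbitrary representation; \<open>wd\<close> shows
    that all representations agree.\<close>
  define \<phi>' where "\<phi>' = (\<lambda>x. SOME c. \<exists>h i. h \<in> H \<and> x = h \<otimes> y [^] (i::nat) \<and> c = \<phi> h * w ^ i)"
  have \<phi>': "\<phi>' (h \<otimes> y [^] i) = \<phi> h * w ^ i" if "h \<in> H" for h and i :: nat
    unfolding \<phi>'_def
  proof (rule some_equality)
    show "\<exists>h' i'. h' \<in> H \<and> h \<otimes> y [^] i = h' \<otimes> y [^] (i'::nat) \<and> \<phi> h * w ^ i = \<phi> h' * w ^ i'"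
      using that by (intro exI[of _ h] exI[of _ i]) simp
    fix c assume "\<exists>h' i'. h' \<in> H \<and> h \<otimes> y [^] i = h' \<otimes> y [^] (i'::nat) \<and> c = \<phi> h' * w ^ i'"
    then obtain h' i' where "h' \<in> H" "h \<otimes> y [^] i = h' \<otimes> y [^] (i'::nat)" "c = \<phi> h' * w ^ i'"
      by blast
    thus "c = \<phi> h * w ^ i" using wd[OF that, of h' i i'] by simp
  qed
  have prod: "(h \<otimes> y [^] i) \<otimes> (h' \<otimes> y [^] j) = (h \<otimes> h') \<otimes> y [^] (i + j)"
    if "h \<in> H" "h' \<in> H" for h h' and i j :: nat
    using that y by (simp add: nat_pow_mult[symmetric] m_ac)
  have "subgroup H' G"
  proof (rule subgroupI)
    show "H' \<subseteq> carrier G" using y by (auto simp: H'_def)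
    have "\<one> \<otimes> y [^] (0::nat) \<in> H'" using H.one_closed unfolding H'_def by blast
    thus "H' \<noteq> {}" by blast
    fix a assume "a \<in> H'"
    then obtain h i where a: "h \<in> H" "a = h \<otimes> y [^] (i::nat)" by (auto simp: H'_def)
    \<comment> \<open>Elements of \<open>H'\<close> use natural exponents only, so the inverse of a
      power of \<open>y\<close> is expressed through the group order.\<close>
    have "y [^] i \<otimes> y [^] (i * (Coset.order G - 1)) = (y [^] Coset.order G) [^] i"
      using y order_pos
      by (simp add: nat_pow_mult nat_pow_pow flip: mult_Suc_right)
        (metis Suc_pred mult.commute mult_Suc_right)
    hence "y [^] i \<otimes> y [^] (i * (Coset.order G - 1)) = \<one>"
      using y by (simp add: pow_order_eq_1)
    hence "inv (y [^] i) = y [^] (i * (Coset.order G - 1))"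
      using y by (metis inv_equality m_comm nat_pow_closed)
    hence "inv a = inv h \<otimes> y [^] (i * (Coset.order G - 1))"
      using a y by (simp add: inv_mult)
    thus "inv a \<in> H'" using a by (auto simp: H'_def)
  next
    fix a b assume "a \<in> H'" "b \<in> H'"
    then obtain h i h' j where "h \<in> H" "a = h \<otimes> y [^] (i::nat)" "h' \<in> H" "b = h' \<otimes> y [^] (j::nat)"
      by (auto simp: H'_def)
    thus "a \<otimes> b \<in> H'" using prod[of h h' i j] by (auto simp: H'_def)
  qed
  moreover have "\<phi>' x \<noteq> 0" if "x \<in> H'" for x using that \<phi>' \<phi>0 w0 by (auto simp: H'_def)
  moreover have "\<phi>' (a \<otimes> b) = \<phi>' a * \<phi>' b" if "a \<in> H'" "b \<in> H'" for a b
  proof -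
    obtain h i h' j where *: "h \<in> H" "a = h \<otimes> y [^] (i::nat)" "h' \<in> H" "b = h' \<otimes> y [^] (j::nat)"
      using \<open>a \<in> H'\<close> \<open>b \<in> H'\<close> by (auto simp: H'_def)
    thus ?thesis by (simp add: prod \<phi>' \<phi>m power_add mult_ac)
  qed
  ultimately have "partial_character H' \<phi>'" by (simp add: partial_character_def)
  moreover have "H \<subseteq> H'"
  proof
    fix h assume "h \<in> H"
    hence "h = h \<otimes> y [^] (0::nat)" by simp
    thus "h \<in> H'" using \<open>h \<in> H\<close> unfolding H'_def by blast
  qed
  moreover have "\<phi>' h = \<phi> h" if "h \<in> H" for h using \<phi>'[OF that, of 0] that by simp
  moreover have y1: "y = \<one> \<otimes> y [^] (1::nat)" using y by simp
  hence "y \<in> H'" using H.one_closed unfolding H'_def by blast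
  moreover have "\<phi>' y = w" using \<phi>'[of \<one> 1] y partial_character_one[OF pc] by simp
  ultimately show ?thesis using that by blast
qed

lemma least_pow_mem:
  assumes "subgroup H G" "y \<in> carrier G"
  obtains r :: nat where "r > 0" "y [^] r \<in> H" "\<And>i::nat. 0 < i \<Longrightarrow> i < r \<Longrightarrow> y [^] i \<notin> H"
proof -
  have "\<exists>r::nat. r > 0 \<and> y [^] r \<in> H"
    using assms order_pos pow_order_eq_1 subgroup.one_closed by metis
  from LeastI_ex[OF this] not_less_Least show ?thesis
    by (intro that[of "LEAST r::nat. r > 0 \<and> y [^] r \<in> H"]) auto
qed

text \<open>Start on the subgroup generated by \<open>x\<close> with a nontrivial root of unity as
  the value at \<open>x\<close>, and extend as long as possible.\<close>

lemma ex_character_neq_1: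
  assumes x: "x \<in> carrier G" "x \<noteq> \<one>"
  obtains \<chi> where "\<chi> \<in> characters G" "\<chi> x \<noteq> 1"
proof -
  \<comment> \<open>Collecting only the subgroups gives a finite set, so a maximal one exists
    without choosing among the characters on it.\<close>
  define S where "S = {H. \<exists>\<phi>. partial_character H \<phi> \<and> x \<in> H \<and> \<phi> x \<noteq> 1}"
  have "S \<subseteq> Pow (carrier G)"
    by (auto simp: S_def partial_character_def dest: subgroup.subset)
  hence finS: "finite S" using fin by (meson finite_Pow_iff finite_subset)
  have triv: "subgroup {\<one>} G" by (rule triv_subgroup)
  have pc1: "partial_character {\<one>} (\<lambda>_. 1)" using triv by (simp add: partial_character_def)
  obtain r :: nat where r: "r > 0" "x [^] r \<in> {\<one>}" "\<And>i::nat. 0 < i \<Longrightarrow> i < r \<Longrightarrow> x [^] i \<notin> {\<one>}"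
    using least_pow_mem[OF triv x(1)] by blast
  have "r \<noteq> 1" using r(2) x by auto
  hence "r > 1" using r(1) by simp
  hence "card {z :: complex. z ^ r = 1} = r" by (intro card_roots_unity_eq) auto
  hence "\<not> {z :: complex. z ^ r = 1} \<subseteq> {1}"
    using card_mono[of "{1 :: complex}" "{z. z ^ r = 1}"] \<open>r > 1\<close> by auto
  then obtain w :: complex where w: "w ^ r = 1" "w \<noteq> 1" by auto
  obtain H0 \<phi>0 where "partial_character H0 \<phi>0" "x \<in> H0" "\<phi>0 x = w"
    using partial_character_extend[OF pc1 x(1) r w(1)] by metis
  hence "S \<noteq> {}" using w by (auto simp: S_def)
  then obtain H where H: "H \<in> S" "\<And>H'. H' \<in> S \<Longrightarrow> \<not> H \<subset> H'"
    using finite_has_maximal[OF finS] by (metis psubsetE subset_antisym)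
  then obtain \<phi> where \<phi>: "partial_character H \<phi>" "x \<in> H" "\<phi> x \<noteq> 1" by (auto simp: S_def)
  interpret H: subgroup H G using \<phi> by (simp add: partial_character_def)
  have "H = carrier G"
  proof (rule ccontr)
    assume "H \<noteq> carrier G"
    then obtain y where y: "y \<in> carrier G" "y \<notin> H" using H.subset by blast
    obtain r :: nat where r: "r > 0" "y [^] r \<in> H" "\<And>i::nat. 0 < i \<Longrightarrow> i < r \<Longrightarrow> y [^] i \<notin> H"
      using least_pow_mem[OF H.subgroup_axioms y(1)] by blast
    \<comment> \<open>Nonzero complex numbers have \<open>r\<close>-th roots, so the character
      always extends to \<open>y\<close>.\<close>
    obtain w where w: "w ^ r = \<phi> (y [^] r)"
    proof -
      have "card {z. z ^ r = \<phi> (y [^] r)} = r"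
        using r \<phi> by (intro card_nth_roots) (auto simp: partial_character_def)
      hence "{z. z ^ r = \<phi> (y [^] r)} \<noteq> {}" using r(1) by (metis card.empty less_numeral_extra(3))
      thus ?thesis using that by blast
    qed
    obtain H' \<phi>' where "partial_character H' \<phi>'" "H \<subseteq> H'" "y \<in> H'" "\<And>h. h \<in> H \<Longrightarrow> \<phi>' h = \<phi> h"
      using partial_character_extend[OF \<phi>(1) y(1) r w] by metis
    with \<phi> y have "H' \<in> S" "H \<subset> H'" by (auto simp: S_def)
    with H(2) show False by blast
  qed
  with \<phi> have "restrict \<phi> (carrier G) \<in> characters G"
    by (auto simp: characters_def hom_def complex_mult_group_def partial_character_def)
  moreover have "restrict \<phi> (carrier G) x \<noteq> 1" using x \<phi> by simp
  ultimately show ?thesis using that by blast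
qed

section \<open>Values of characters and orthogonality\<close>

context
  fixes \<chi> assumes \<chi>: "\<chi> \<in> characters G"
begin

lemma character_mult: "x \<in> carrier G \<Longrightarrow> y \<in> carrier G \<Longrightarrow> \<chi> (x \<otimes> y) = \<chi> x * \<chi> y"
  using \<chi> by (auto simp: characters_def hom_def complex_mult_group_def)

lemma character_nonzero: "x \<in> carrier G \<Longrightarrow> \<chi> x \<noteq> 0"
  using \<chi> by (auto simp: characters_def hom_def complex_mult_group_def)

lemma character_one: "\<chi> \<one> = 1"
  using character_mult[of \<one> \<one>] character_nonzero[of \<one>] by simp

lemma character_pow: "x \<in> carrier G \<Longrightarrow> \<chi> (x [^] (n :: nat)) = \<chi> x ^ n"
  by (induction n) (auto simp: character_one character_mult)

lemma character_root_unity: "x \<in> carrier G \<Longrightarrow> \<chi> x ^ Coset.order G = 1"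
  by (simp add: character_pow[symmetric] pow_order_eq_1 character_one)

lemma algebraic_int_character: "x \<in> carrier G \<Longrightarrow> algebraic_int (\<chi> x)"
  using character_root_unity order_pos algebraic_int_root_unity by blast

lemma norm_character: "x \<in> carrier G \<Longrightarrow> cmod (\<chi> x) = 1"
  using character_root_unity order_pos by (metis norm_one norm_power norm_ge_zero power_eq_1_iff neq0_conv)

lemma character_mult_cnj: "x \<in> carrier G \<Longrightarrow> \<chi> x * cnj (\<chi> x) = 1"
  using norm_character by (simp add: complex_norm_square[symmetric])

lemma character_inv: "x \<in> carrier G \<Longrightarrow> \<chi> (inv x) = cnj (\<chi> x)"
proof -
  assume x: "x \<in> carrier G"
  have "\<chi> x * \<chi> (inv x) = \<chi> x * cnj (\<chi> x)"
    using x by (simp add: character_mult[symmetric] character_one character_mult_cnj)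
  thus ?thesis using character_nonzero[OF x] by simp
qed

end

lemma principal_mem_characters: "principal_character G \<in> characters G"
  by (auto simp: characters_def hom_def complex_mult_group_def principal_character_def)

lemma characters_mult:
  "\<chi> \<in> characters G \<Longrightarrow> \<psi> \<in> characters G \<Longrightarrow> (\<lambda>x\<in>carrier G. \<chi> x * \<psi> x) \<in> characters G"
  by (auto simp: characters_def hom_def complex_mult_group_def)

lemma characters_power:
  "\<chi> \<in> characters G \<Longrightarrow> (\<lambda>x\<in>carrier G. \<chi> x ^ n) \<in> characters G"
  by (auto simp: characters_def hom_def complex_mult_group_def power_mult_distrib)

lemma finite_characters: "finite (characters G)"
proof -
  have "characters G \<subseteq> PiE (carrier G) (\<lambda>_. {z. z ^ Coset.order G = 1})"
    using character_root_unity by (auto simp: characters_def PiE_def)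
  moreover have "finite (PiE (carrier G) (\<lambda>_. {z :: complex. z ^ Coset.order G = 1}))"
    using fin order_pos by (intro finite_PiE finite_roots_unity) auto
  ultimately show ?thesis by (rule finite_subset)
qed

lemma character_eqI:
  "\<chi> \<in> characters G \<Longrightarrow> \<psi> \<in> characters G \<Longrightarrow> (\<And>x. x \<in> carrier G \<Longrightarrow> \<chi> x = \<psi> x) \<Longrightarrow> \<chi> = \<psi>"
  by (auto simp: characters_def intro: extensionalityI)

lemma bij_betw_mult_carrier: "y \<in> carrier G \<Longrightarrow> bij_betw (\<lambda>x. x \<otimes> y) (carrier G) (carrier G)"
  by (rule bij_betw_byWitness[of _ "\<lambda>x. x \<otimes> inv y"]) (auto simp: m_assoc)

lemma sum_mult_carrier: "y \<in> carrier G \<Longrightarrow> (\<Sum>x\<in>carrier G. f (x \<otimes> y)) = sum f (carrier G)"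
  by (rule sum.reindex_bij_betw[OF bij_betw_mult_carrier])

text \<open>Translating by some \<open>y\<close> with \<open>\<chi> y\<close> different from 1
  multiplies the sum by \<open>\<chi> y\<close> and leaves it unchanged.\<close>

lemma sum_character_eq_0:
  assumes "\<chi> \<in> characters G" "\<chi> \<noteq> principal_character G"
  shows "sum \<chi> (carrier G) = 0"
proof -
  obtain y where y: "y \<in> carrier G" "\<chi> y \<noteq> 1"
    using assms character_eqI[OF assms(1) principal_mem_characters]
    by (auto simp: principal_character_def)
  have "sum \<chi> (carrier G) = (\<Sum>x\<in>carrier G. \<chi> (x \<otimes> y))" by (rule sum_mult_carrier[OF y(1), symmetric])
  also have "\<dots> = sum \<chi> (carrier G) * \<chi> y"
    using y assms by (simp add: character_mult sum_distrib_right)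
  finally show ?thesis using y by simp
qed

section \<open>Characters of quotients and duality for subgroups\<close>

definition annihilator :: "'a set \<Rightarrow> ('a \<Rightarrow> complex) set" where
  "annihilator M = {\<chi> \<in> characters G. \<forall>x\<in>M. \<chi> x = 1}"

lemma quotient_finite_comm_group:
  assumes "subgroup M G"
  shows "finite_comm_group (G Mod M)"
proof -
  interpret Q: comm_group "G Mod M" using assms by (rule abelian_FactGroup)
  show ?thesis by unfold_locales (use fin in \<open>simp add: carrier_FactGroup\<close>)
qed

lemma quotient_hom:
  assumes "subgroup M G"
  shows "(\<lambda>x. M #> x) \<in> hom G (G Mod M)"
  using normal.r_coset_hom_Mod[OF subgroup_imp_normal[OF assms]] .

text \<open>Pullback along the quotient map, restricted to the carrier so that the result is
  extensional and counts as one character.\<close>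

definition lift :: "'a set \<Rightarrow> ('a set \<Rightarrow> complex) \<Rightarrow> 'a \<Rightarrow> complex" where
  "lift M \<chi> = (\<lambda>x\<in>carrier G. \<chi> (M #> x))"

lemma lift_mem_annihilator:
  assumes "subgroup M G" "\<chi> \<in> characters (G Mod M)"
  shows "lift M \<chi> \<in> annihilator M"
proof -
  interpret Q: finite_comm_group "G Mod M" using assms(1) by (rule quotient_finite_comm_group)
  have c: "M #> x \<in> carrier (G Mod M)" if "x \<in> carrier G" for x
    using that by (simp add: carrier_FactGroup)
  have m: "M #> (x \<otimes> y) = (M #> x) \<otimes>\<^bsub>G Mod M\<^esub> (M #> y)" if "x \<in> carrier G" "y \<in> carrier G" for x y
    using hom_mult[OF quotient_hom[OF assms(1)]] that by simp
  have "lift M \<chi> \<in> characters G"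
    using Q.character_nonzero[OF assms(2)] Q.character_mult[OF assms(2)]
    by (auto simp: lift_def characters_def hom_def complex_mult_group_def c m simp del: mult_FactGroup)
  moreover have "\<chi> (M #> x) = 1" if "x \<in> M" for x
    using that assms Q.character_one[OF assms(2)] by (simp add: coset_join2 subgroup.mem_carrier)
  ultimately show ?thesis
    using subgroup.mem_carrier[OF assms(1)] by (simp add: annihilator_def lift_def)
qed

lemma lift_mem_characters:
  "subgroup M G \<Longrightarrow> \<chi> \<in> characters (G Mod M) \<Longrightarrow> lift M \<chi> \<in> characters G"
  using lift_mem_annihilator by (simp add: annihilator_def)

text \<open>The coset of \<open>x\<close> is nontrivial in \<open>G Mod M\<close>; a character
  separating it from the identity lifts to \<open>G\<close>.\<close>

lemma ex_annihilator_neq_1: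
  assumes M: "subgroup M G" and x: "x \<in> carrier G" "x \<notin> M"
  obtains \<chi> where "\<chi> \<in> annihilator M" "\<chi> x \<noteq> 1"
proof -
  interpret Q: finite_comm_group "G Mod M" using M by (rule quotient_finite_comm_group)
  have "M #> x \<noteq> M" using x M coset_join1 subgroup.subset by blast
  moreover have "M #> x \<in> carrier (G Mod M)" using x by (simp add: carrier_FactGroup)
  ultimately obtain \<chi> where \<chi>: "\<chi> \<in> characters (G Mod M)" "\<chi> (M #> x) \<noteq> 1"
    using Q.ex_character_neq_1[of "M #> x"] by auto
  have "lift M \<chi> x \<noteq> 1" using x \<chi> by (simp add: lift_def)
  from that[OF lift_mem_annihilator[OF M \<chi>(1)] this] show ?thesis .
qed

lemma finite_annihilator: "finite (annihilator M)"
  using finite_characters by (simp add: annihilator_def)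

lemma bij_betw_mult_annihilator:
  assumes "\<psi> \<in> annihilator M" "M \<subseteq> carrier G"
  shows "bij_betw (\<lambda>\<chi>. \<lambda>x\<in>carrier G. \<chi> x * \<psi> x) (annihilator M) (annihilator M)"
proof -
  let ?f = "\<lambda>\<chi>. \<lambda>x\<in>carrier G. \<chi> x * \<psi> x"
  have sub: "?f ` annihilator M \<subseteq> annihilator M"
    using assms characters_mult by (auto simp: annihilator_def)
  have inj: "inj_on ?f (annihilator M)"
  proof (rule inj_onI)
    fix \<chi> \<chi>' assume *: "\<chi> \<in> annihilator M" "\<chi>' \<in> annihilator M" "?f \<chi> = ?f \<chi>'"
    show "\<chi> = \<chi>'"
    proof (rule character_eqI)
      fix x assume "x \<in> carrier G"
      moreover from this have "\<psi> x \<noteq> 0" using assms(1) character_nonzero by (simp add: annihilator_def)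
      ultimately show "\<chi> x = \<chi>' x" using fun_cong[OF *(3), of x] by simp
    qed (use * in \<open>auto simp: annihilator_def\<close>)
  qed
  from endo_inj_surj[OF finite_annihilator sub inj] inj show ?thesis by (simp add: bij_betw_def)
qed

text \<open>Dual orthogonality: for \<open>x\<close> outside \<open>M\<close>, multiplication by a
  member of the annihilator that is nontrivial at \<open>x\<close> permutes the summands and
  rescales the sum.\<close>

lemma sum_annihilator:
  assumes M: "subgroup M G" and x: "x \<in> carrier G"
  shows "(\<Sum>\<chi>\<in>annihilator M. \<chi> x) = (if x \<in> M then of_nat (card (annihilator M)) else 0)"
proof (cases "x \<in> M")
  case False
  obtain \<psi> where \<psi>: "\<psi> \<in> annihilator M" "\<psi> x \<noteq> 1" using ex_annihilator_neq_1[OF M x False] by blast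
  have "(\<Sum>\<chi>\<in>annihilator M. \<chi> x) = (\<Sum>\<chi>\<in>annihilator M. (\<lambda>x\<in>carrier G. \<chi> x * \<psi> x) x)"
    by (rule sum.reindex_bij_betw[symmetric, OF bij_betw_mult_annihilator[OF \<psi>(1) subgroup.subset[OF M]]])
  also have "\<dots> = (\<Sum>\<chi>\<in>annihilator M. \<chi> x) * \<psi> x" using x by (simp add: sum_distrib_right)
  finally show ?thesis using False \<psi> by simp
qed (simp add: annihilator_def)

text \<open>Sum \<open>\<chi> x\<close> over \<open>x\<close> in \<open>G\<close> and
  \<open>\<chi>\<close> in the annihilator in both orders. For the trivial subgroup this counts all
  characters.\<close>

lemma card_annihilator:
  assumes M: "subgroup M G"
  shows "card (annihilator M) * card M = Coset.order G"
proof -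
  have pr: "principal_character G \<in> annihilator M"
    using principal_mem_characters subgroup.mem_carrier[OF M]
    by (auto simp: annihilator_def principal_character_def)
  have "of_nat (card (annihilator M) * card M) =
      (\<Sum>x\<in>carrier G. if x \<in> M then of_nat (card (annihilator M)) else (0 :: complex))"
    using fin subgroup.subset[OF M] by (simp add: sum.If_cases Int_absorb1 mult.commute)
  also have "\<dots> = (\<Sum>x\<in>carrier G. \<Sum>\<chi>\<in>annihilator M. \<chi> x)"
    by (simp add: sum_annihilator[OF M])
  also have "\<dots> = (\<Sum>\<chi>\<in>annihilator M. sum \<chi> (carrier G))" by (rule sum.swap)
  also have "\<dots> = (\<Sum>\<chi>\<in>annihilator M. if \<chi> = principal_character G then of_nat (Coset.order G) else 0)"
    by (intro sum.cong refl)
      (auto simp: sum_character_eq_0 annihilator_def principal_character_def Coset.order_def)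
  also have "\<dots> = of_nat (Coset.order G)" using pr finite_annihilator by simp
  finally show ?thesis by (simp only: of_nat_eq_iff)
qed

end

section \<open>Groups with a cyclic self-conjugate Sylow subgroup\<close>

text \<open>Raising to such a power kills elements of order dividing \<open>p ^ s\<close> and fixes
  those of order dividing \<open>h\<close>: it projects onto the \<open>p\<close>-regular
  part.\<close>

lemma ex_prime_power_cong_1:
  assumes p: "prime (p :: nat)" and h: "coprime p h" "h > 0"
  obtains k where "p ^ s dvd p ^ k" "h dvd p ^ k - 1" "p ^ k \<ge> 2"
proof -
  \<comment> \<open>\<open>Suc s\<close> rather than \<open>s\<close> keeps \<open>k\<close>
    positive, which gives \<open>p ^ k \<ge> 2\<close>.\<close>
  define k where "k = totient h * Suc s"
  have "totient h \<ge> 1" using h(2) by (simp add: Suc_le_eq)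
  hence "1 * Suc s \<le> k" unfolding k_def by (rule mult_le_mono1)
  hence k: "k \<ge> Suc s" by simp
  have "[p ^ totient h = 1] (mod h)" using h(1) by (rule euler_theorem)
  hence "[(p ^ totient h) ^ Suc s = 1 ^ Suc s] (mod h)" by (rule cong_pow)
  hence "[p ^ k = 1] (mod h)" by (simp only: k_def power_mult power_one)
  hence "h dvd p ^ k - 1" by (rule cong_to_1_nat)
  moreover have "p ^ s dvd p ^ k" using k by (intro le_imp_power_dvd) simp
  moreover have "p ^ k \<ge> p ^ 1" using k prime_ge_1_nat[OF p] by (intro power_increasing) auto
  hence "p ^ k \<ge> 2" using prime_ge_2_nat[OF p] by simp
  ultimately show ?thesis using that by blast
qed

text \<open>The situation in the quotient by \<open>N\<close>: \<open>t\<close> generates a cyclic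
  Sylow \<open>p\<close>-subgroup. The form of \<open>self_conj\<close> says that once the
  \<open>p\<close>-part is removed by the exponent \<open>p ^ s\<close>, raising to the power
  \<open>p ^ j\<close> is inversion.\<close>

locale cyclic_sylow = finite_comm_group G for G (structure) +
  fixes p s h j :: nat and t :: 'a
  assumes p: "prime p" and s: "s > 0" and order_G: "Coset.order G = p ^ s * h"
    and coprime_ph: "coprime p h"
    and t: "t \<in> carrier G" and t_pow: "t [^] (p ^ s) = \<one>"
    and t_pow': "t [^] (p ^ (s - 1)) \<noteq> \<one>"
    and self_conj: "\<And>x. x \<in> carrier G \<Longrightarrow> x [^] (p ^ s * (p ^ j + 1)) = \<one>"
begin

abbreviation "T \<equiv> generate G {t}"
abbreviation "g \<equiv> t [^] (p ^ (s - 1))"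

lemma p_pos: "p > 0" using p by (rule prime_gt_0_nat)

lemma h_pos: "h > 0" using order_pos order_G by (metis mult_0_right neq0_conv)

lemma ord_t: "ord t = p ^ s"
  by (rule ord_eq_prime_power[OF p t t_pow t_pow'])

lemma subgroup_T: "subgroup T G" using t by (intro generate_is_subgroup) auto

lemma card_T: "card T = p ^ s" using generate_pow_card[OF t] ord_t by simp

lemma T_eq: "T = {t [^] i | i :: nat. i \<in> UNIV}"
  using generate_pow_nat[OF t] ord_t p_pos by simp

lemma t_pow_eq_iff: "t [^] (i :: nat) = t [^] k \<longleftrightarrow> [i = k] (mod p ^ s)"
  using int_pow_eq[OF t, of "int i" "int k"] ord_t
  by (simp add: int_pow_int cong_iff_dvd_diff dvd_diff_commute flip: cong_int_iff)

text \<open>The quotient by \<open>T\<close> has order \<open>h\<close>.\<close>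

lemma pow_h_mem_T: "x \<in> carrier G \<Longrightarrow> x [^] h \<in> T"
proof -
  assume x: "x \<in> carrier G"
  interpret N: normal T G using subgroup_imp_normal[OF subgroup_T] .
  interpret Q: finite_comm_group "G Mod T" using subgroup_T by (rule quotient_finite_comm_group)
  have "card (rcosets T) * p ^ s = p ^ s * h" using lagrange[OF subgroup_T] card_T order_G by simp
  hence "Coset.order (G Mod T) = h" using p_pos by (simp add: Coset.order_def FactGroup_def)
  hence "(T #> x) [^]\<^bsub>G Mod T\<^esub> h = T"
    using Q.pow_order_eq_1[of "T #> x"] x by (simp add: carrier_FactGroup)
  hence "T #> (x [^] h) = T" using N.FactGroup_pow[OF x] by simp
  thus ?thesis using coset_join1[OF _ _ subgroup_T] subgroup.subset[OF subgroup_T] x by simp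
qed

text \<open>
  As \<open>h\<close> is invertible modulo \<open>p\<^sup>s\<close>, the equation below fixes \<open>index x\<close>, and it advances by one modulo
  \<open>p\<^sup>s\<close> along \<open>x \<mapsto> x \<otimes> t\<close>: a coordinate on the \<open>T\<close>-cosets that needs no choice of representatives.
\<close>

definition index :: "'a \<Rightarrow> nat" where
  "index x = (SOME i. i < p ^ s \<and> x [^] h = t [^] (h * i))"

lemma index_eqI:
  assumes "i < p ^ s" "x [^] h = t [^] (h * i)"
  shows "index x = i"
  unfolding index_def
proof (rule some_equality)
  fix k assume k: "k < p ^ s \<and> x [^] h = t [^] (h * k)"
  hence "[h * k = h * i] (mod p ^ s)" using assms t_pow_eq_iff by metis
  hence "[k = i] (mod p ^ s)"
    using coprime_ph by (simp add: cong_mult_lcancel_nat coprime_commute)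
  thus "k = i" using k assms(1) by (simp add: cong_def)
qed (use assms in simp)

lemma index:
  assumes x: "x \<in> carrier G"
  shows "index x < p ^ s" "x [^] h = t [^] (h * index x)"
proof -
  obtain m :: nat where m: "x [^] h = t [^] m" using pow_h_mem_T[OF x] T_eq by auto
  obtain u where u: "[h * u = 1] (mod p ^ s)"
    using cong_solve_coprime_nat[of h "p ^ s"] coprime_ph by (auto simp: coprime_commute)
  define i where "i = u * m mod p ^ s"
  have "[h * i = h * (u * m)] (mod p ^ s)" unfolding i_def by (intro cong_scalar_left) simp
  also have "h * (u * m) = (h * u) * m" by simp
  also have "[(h * u) * m = 1 * m] (mod p ^ s)" using u by (rule cong_scalar_right)
  finally have "t [^] (h * i) = t [^] m" by (simp add: t_pow_eq_iff)
  hence "i < p ^ s" "x [^] h = t [^] (h * i)" using m p_pos by (simp_all add: i_def)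
  with index_eqI[OF this] show "index x < p ^ s" "x [^] h = t [^] (h * index x)" by auto
qed

lemma index_mult_t:
  assumes x: "x \<in> carrier G"
  shows "index (x \<otimes> t) = (if Suc (index x) < p ^ s then Suc (index x) else 0)"
proof (rule index_eqI)
  have "(x \<otimes> t) [^] h = t [^] (h * Suc (index x))"
    using x t index(2)[OF x] by (simp add: nat_pow_distrib nat_pow_mult add.commute)
  moreover have "t [^] (h * Suc (index x)) = \<one>" if "\<not> Suc (index x) < p ^ s"
  proof -
    have "Suc (index x) = p ^ s" using that index(1)[OF x] by simp
    thus ?thesis using t t_pow by (metis mult.commute nat_pow_one nat_pow_pow)
  qed
  ultimately show "(x \<otimes> t) [^] h =
      t [^] (h * (if Suc (index x) < p ^ s then Suc (index x) else 0))" by auto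
qed (use p_pos in simp)

section \<open>The difference operator along \<open>t\<close>\<close>

text \<open>On coefficient functions this is multiplication by 1 minus the inverse of
  \<open>t\<close> in the group ring; the inverse is why \<open>cnj (\<chi> t)\<close> appears in
  the character sums.\<close>

definition diff :: "('a \<Rightarrow> int) \<Rightarrow> 'a \<Rightarrow> int" where
  "diff a x = a x - a (x \<otimes> t)"

lemma diff_pow_Suc: "(diff ^^ Suc n) a x = (diff ^^ n) a x - (diff ^^ n) a (x \<otimes> t)"
  by (simp only: funpow.simps comp_apply diff_def)

text \<open>The witness is the partial sum of \<open>a\<close> from \<open>x\<close> to the end of its orbit.\<close>

lemma ex_diff_cong:
  fixes a :: "'a \<Rightarrow> int"
  assumes "\<And>y. y \<in> carrier G \<Longrightarrow> int p dvd (\<Sum>i<p ^ s. a (y \<otimes> t [^] i))"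
  shows "\<exists>b. \<forall>x\<in>carrier G. int p dvd a x - diff b x"
proof (intro exI ballI)
  define b where "b = (\<lambda>x. \<Sum>i<p ^ s - index x. a (x \<otimes> t [^] i))"
  fix x assume x: "x \<in> carrier G"
  have shift: "x \<otimes> t \<otimes> t [^] i = x \<otimes> t [^] Suc i" for i
    using x t by (simp only: m_assoc nat_pow_closed nat_pow_Suc2)
  have len: "p ^ s - index x = Suc (p ^ s - Suc (index x))" using index(1)[OF x] by simp
  have b: "b x = a x + (\<Sum>i<p ^ s - Suc (index x). a (x \<otimes> t \<otimes> t [^] i))"
    unfolding b_def len sum.lessThan_Suc_shift shift using x by simp
  show "int p dvd a x - diff b x"
  proof (cases "Suc (index x) < p ^ s")
    case True
    hence "diff b x = a x" unfolding diff_def b by (simp add: b_def index_mult_t[OF x])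
    thus ?thesis by simp
  next
    \<comment> \<open>At the last point of an orbit the index wraps to 0, so \<open>b x\<close> is
      \<open>a x\<close> and \<open>b (x \<otimes> t)\<close> is the full orbit sum. This is the
      only error, and it is divisible by \<open>p\<close>.\<close>
    case False
    hence "a x - diff b x = (\<Sum>i<p ^ s. a (x \<otimes> t \<otimes> t [^] i))"
      unfolding diff_def b by (simp add: b_def index_mult_t[OF x])
    thus ?thesis using assms[of "x \<otimes> t"] x t by simp
  qed
qed

lemma diff_pow_cong:
  assumes "\<And>x. x \<in> carrier G \<Longrightarrow> n dvd a x - b x" "x \<in> carrier G"
  shows "n dvd (diff ^^ r) a x - (diff ^^ r) b x"
  using assms(2)
proof (induction r arbitrary: x)
  case (Suc r)
  have "(diff ^^ Suc r) a x - (diff ^^ Suc r) b x =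
     ((diff ^^ r) a x - (diff ^^ r) b x) - ((diff ^^ r) a (x \<otimes> t) - (diff ^^ r) b (x \<otimes> t))"
    by (simp only: diff_pow_Suc)
  thus ?case using Suc t by (auto intro!: dvd_diff)
qed (use assms in simp)

lemma diff_pow_binomial:
  assumes "x \<in> carrier G"
  shows "(diff ^^ n) a x = (\<Sum>k\<le>n. (- 1) ^ k * int (n choose k) * a (x \<otimes> t [^] k))"
  using assms
proof (induction n arbitrary: x)
  case (Suc n)
  let ?f = "\<lambda>k::nat. a (x \<otimes> t [^] k)"
  have shift: "x \<otimes> t \<otimes> t [^] k = x \<otimes> t [^] Suc k" for k
    using Suc.prems t by (simp only: m_assoc nat_pow_closed nat_pow_Suc2)
  have "(\<Sum>k\<le>Suc n. (- 1) ^ k * int (Suc n choose k) * ?f k) =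
      ?f 0 + (\<Sum>k\<le>n. (- 1) ^ Suc k * int (Suc n choose Suc k) * ?f (Suc k))"
    by (subst sum.atMost_Suc_shift) simp
  also have "\<dots> = (?f 0 + (\<Sum>k\<le>n. (- 1) ^ Suc k * int (n choose Suc k) * ?f (Suc k)))
      - (\<Sum>k\<le>n. (- 1) ^ k * int (n choose k) * ?f (Suc k))"
    by (simp add: algebra_simps sum.distrib sum_negf sum_subtractf)
  also have "?f 0 + (\<Sum>k\<le>n. (- 1) ^ Suc k * int (n choose Suc k) * ?f (Suc k)) =
      (\<Sum>k\<le>Suc n. (- 1) ^ k * int (n choose k) * ?f k)"
    by (subst sum.atMost_Suc_shift) simp
  also have "\<dots> = (\<Sum>k\<le>n. (- 1) ^ k * int (n choose k) * ?f k)" by simp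
  also have "\<dots> - (\<Sum>k\<le>n. (- 1) ^ k * int (n choose k) * ?f (Suc k)) = (diff ^^ Suc n) a x"
    using Suc.prems Suc.IH[of x] Suc.IH[of "x \<otimes> t"] t by (simp only: diff_pow_Suc shift m_closed)
  finally show ?case ..
qed simp

text \<open>Frobenius for the operator: modulo \<open>p\<close> only the two outer terms of the
  binomial expansion survive.\<close>

lemma diff_prime_power_cong:
  assumes x: "x \<in> carrier G"
  shows "int p dvd (diff ^^ (p ^ k)) a x - (a x - a (x \<otimes> t [^] (p ^ k)))"
proof -
  let ?q = "p ^ k" and ?f = "\<lambda>i. (- 1) ^ i * int (p ^ k choose i) * a (x \<otimes> t [^] i)"
  have "{..?q} = insert 0 (insert ?q {0<..<?q})" using p_pos by auto
  hence "(diff ^^ ?q) a x = a x + (- 1) ^ ?q * a (x \<otimes> t [^] ?q) + (\<Sum>i\<in>{0<..<?q}. ?f i)"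
    unfolding diff_pow_binomial[OF x] using p_pos x by simp
  hence "(diff ^^ ?q) a x - (a x - a (x \<otimes> t [^] ?q)) =
     ((- 1) ^ ?q - (- 1)) * a (x \<otimes> t [^] ?q) + (\<Sum>i\<in>{0<..<?q}. ?f i)"
    by (simp add: algebra_simps)
  moreover have "int p dvd ?f i" if "i \<in> {0<..<?q}" for i
    using prime_dvd_choose_prime_power[OF p, of i k] that by simp
  hence "int p dvd (\<Sum>i\<in>{0<..<?q}. ?f i)" by (rule dvd_sum)
  moreover have "int p dvd (- 1) ^ ?q - (- 1)" by (rule prime_dvd_power_diff_self[OF p])
  ultimately show ?thesis by (simp add: dvd_add)
qed

section \<open>Character sums and their Frobenius twists\<close>

definition charsum :: "('a \<Rightarrow> complex) \<Rightarrow> ('a \<Rightarrow> int) \<Rightarrow> complex" where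
  "charsum \<chi> a = (\<Sum>x\<in>carrier G. of_int (a x) * \<chi> x)"

lemma algebraic_int_charsum: "\<chi> \<in> characters G \<Longrightarrow> algebraic_int (charsum \<chi> a)"
  unfolding charsum_def by (intro algebraic_int_intros) (auto intro: algebraic_int_character)

lemma charsum_diff:
  assumes "\<chi> \<in> characters G"
  shows "charsum \<chi> (diff b) = (1 - cnj (\<chi> t)) * charsum \<chi> b"
proof -
  have "(\<Sum>x\<in>carrier G. of_int (b (x \<otimes> t)) * \<chi> x) =
      (\<Sum>x\<in>carrier G. of_int (b (x \<otimes> t)) * \<chi> (x \<otimes> t) * cnj (\<chi> t))"
    using t character_mult_cnj[OF assms t]
    by (intro sum.cong) (simp_all add: character_mult[OF assms] mult.assoc)
  also have "\<dots> = (\<Sum>x\<in>carrier G. of_int (b x) * \<chi> x * cnj (\<chi> t))"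
    by (rule sum_mult_carrier[OF t])
  finally show ?thesis
    by (simp add: charsum_def diff_def algebra_simps sum_subtractf sum_distrib_left sum_distrib_right)
qed

lemma charsum_diff_pow:
  "\<chi> \<in> characters G \<Longrightarrow> charsum \<chi> ((diff ^^ r) b) = (1 - cnj (\<chi> t)) ^ r * charsum \<chi> b"
  by (induction r) (simp_all add: charsum_diff)

text \<open>Substituting \<open>x \<otimes> y\<close> for \<open>x\<close> multiplies the sum by
  \<open>\<chi> y\<close>. This serves both to discard residues modulo \<open>p\<close> and to
  produce vanishing characters.\<close>

lemma charsum_invariant:
  assumes \<chi>: "\<chi> \<in> characters G" and y: "y \<in> carrier G" "\<chi> y \<noteq> 1"
    and inv: "\<And>x. x \<in> carrier G \<Longrightarrow> a (x \<otimes> y) = a x"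
  shows "charsum \<chi> a = 0"
proof -
  have "charsum \<chi> a = (\<Sum>x\<in>carrier G. of_int (a (x \<otimes> y)) * \<chi> (x \<otimes> y))"
    unfolding charsum_def by (rule sum_mult_carrier[OF y(1), symmetric])
  also have "\<dots> = charsum \<chi> a * \<chi> y"
    unfolding charsum_def sum_distrib_right
    using y by (intro sum.cong) (simp_all add: inv character_mult[OF \<chi>])
  finally show ?thesis using y by simp
qed

context
  fixes \<chi> assumes \<chi>: "\<chi> \<in> characters G" and \<chi>g: "\<chi> g \<noteq> 1"
begin

abbreviation "z \<equiv> cnj (\<chi> t)"

lemma \<chi>t_pow: "\<chi> t ^ (p ^ s) = 1"
  using t_pow t by (simp flip: character_pow[OF \<chi>] add: character_one[OF \<chi>])

lemma z_pow: "z ^ (p ^ s) = 1" "z ^ (p ^ (s - 1)) \<noteq> 1"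
proof -
  show "z ^ (p ^ s) = 1" using arg_cong[OF \<chi>t_pow, of cnj] by simp
  have "z ^ (p ^ (s - 1)) = cnj (\<chi> g)" using t by (simp add: character_pow[OF \<chi>])
  moreover have "cnj (\<chi> g) \<noteq> cnj 1" using \<chi>g unfolding complex_cnj_cancel_iff .
  ultimately show "z ^ (p ^ (s - 1)) \<noteq> 1" by simp
qed

lemma z_neq_1: "z \<noteq> 1" using z_pow(2) by auto

lemma algebraic_int_z: "algebraic_int z" using algebraic_int_character[OF \<chi> t] by simp

lemma pi_advd_p: "1 - z advd of_nat p"
proof -
  have "p ^ (s - 1) < p ^ s" using s prime_gt_1_nat[OF p] by (intro power_strict_increasing) auto
  hence "1 - z advd (1 - z) ^ (p ^ s - p ^ (s - 1))"
    using algebraic_int_z by (intro advd_power_gt_0 advd_refl algebraic_int_intros) auto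
  thus ?thesis using power_one_minus_root_advd_prime[OF p s z_pow] by (rule advd_trans)
qed

text \<open>\<open>\<chi> t\<close> is the inverse of \<open>z\<close>, hence itself a power of
  \<open>z\<close>.\<close>

lemma pi_advd_one_minus: "1 - z advd 1 - \<chi> t ^ m"
proof -
  have "\<chi> t * z = 1" by (rule character_mult_cnj[OF \<chi> t])
  moreover have "z ^ (p ^ s - 1) * z = 1"
    using z_pow(1) p_pos by (simp flip: power_Suc2)
  ultimately have "\<chi> t = z ^ (p ^ s - 1)"
    by (metis mult.commute mult.left_commute mult_1_right)
  hence "\<chi> t ^ m = z ^ ((p ^ s - 1) * m)" by (simp add: power_mult)
  thus ?thesis using one_minus_advd_one_minus_power[OF algebraic_int_z] by simp
qed

text \<open>The conjugate of \<open>1 - z\<close> is \<open>1 - \<chi> t\<close>, a multiple of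
  \<open>1 - z\<close>, so divisibility by \<open>1 - z\<close> is stable under conjugation.\<close>

lemma pi_advd_cnj:
  assumes "1 - z advd a"
  shows "1 - z advd cnj a"
proof -
  obtain c where "algebraic_int c" "a = (1 - z) * c" using assms by (auto simp: alg_dvd_def)
  hence "cnj (1 - z) advd cnj a" by (intro advdI[of "cnj c"]) auto
  moreover have "1 - z advd cnj (1 - z)" using pi_advd_one_minus[of 1] by simp
  ultimately show ?thesis using advd_trans by blast
qed

text \<open>The twisted sum \<open>\<eta>\<close> belongs to the \<open>p\<close>-regular part of
  \<open>\<chi>\<close>. It is nilpotent modulo \<open>p\<close> by the norm condition and fixed
  modulo \<open>p\<close> by a power of Frobenius, hence zero modulo \<open>p\<close>.\<close>

lemma p_advd_twisted_charsum:
  assumes norm: "1 - z advd charsum \<chi> a * cnj (charsum \<chi> a)"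
    and k: "p ^ s dvd p ^ k" "h dvd p ^ k - 1" "p ^ k \<ge> 2"
  shows "of_nat p advd (\<Sum>x\<in>carrier G. of_int (a x) * \<chi> x ^ (p ^ k))"
proof -
  define Q where "Q = p ^ k"
  define q where "q = p ^ (j + k)"
  define S where "S = charsum \<chi> a"
  define \<eta> where "\<eta> = (\<Sum>x\<in>carrier G. of_int (a x) * \<chi> x ^ Q)"
  note ai = algebraic_int_character[OF \<chi>]
  have aS: "algebraic_int S" unfolding S_def by (rule algebraic_int_charsum[OF \<chi>])
  have a\<eta>: "algebraic_int \<eta>" unfolding \<eta>_def by (intro algebraic_int_intros ai)
  have frob: "of_nat p advd (\<Sum>x\<in>carrier G. of_int (a x) * \<chi> x ^ m) ^ (p ^ l) -
      (\<Sum>x\<in>carrier G. of_int (a x) * \<chi> x ^ (m * p ^ l))" for m l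
    using advd_sum_prime_power[OF p fin, of "\<lambda>x. \<chi> x ^ m" a l] ai
    by (simp add: power_mult algebraic_int_power)
  \<comment> \<open>\<open>h\<close> divides \<open>Q - 1\<close> and \<open>x [^] h\<close> lies in
    \<open>T\<close>, so \<open>\<chi> x ^ (Q - 1)\<close> is a power of \<open>\<chi> t\<close> and
    thus 1 modulo \<open>1 - z\<close>.\<close>
  have S\<eta>: "1 - z advd S - \<eta>"
  proof -
    have "1 - z advd of_int (a x) * (\<chi> x * (1 - \<chi> x ^ (Q - 1)))" if x: "x \<in> carrier G" for x
    proof -
      obtain i :: nat where "x [^] h = t [^] i" using pow_h_mem_T[OF x] T_eq by auto
      hence xh: "\<chi> x ^ h = \<chi> t ^ i" using x t by (simp flip: character_pow[OF \<chi>])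
      obtain c where "Q - 1 = h * c" using k(2) by (auto simp: Q_def)
      hence "\<chi> x ^ (Q - 1) = \<chi> t ^ (i * c)" using xh by (simp add: power_mult)
      thus ?thesis using pi_advd_one_minus by (auto intro!: advd_mult' ai x)
    qed
    hence "1 - z advd (\<Sum>x\<in>carrier G. of_int (a x) * (\<chi> x * (1 - \<chi> x ^ (Q - 1))))"
      by (rule advd_sum)
    also have "(\<Sum>x\<in>carrier G. of_int (a x) * (\<chi> x * (1 - \<chi> x ^ (Q - 1)))) = S - \<eta>"
    proof -
      have "\<chi> x * \<chi> x ^ (Q - 1) = \<chi> x ^ Q" for x
        using k(3) by (metis Q_def Suc_diff_1 less_le_trans pos2 power_Suc)
      thus ?thesis
        unfolding S_def \<eta>_def charsum_def sum_subtractf[symmetric]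
        by (intro sum.cong) (simp_all add: right_diff_distrib)
    qed
    finally show ?thesis .
  qed
  \<comment> \<open>Since \<open>p ^ s\<close> divides \<open>Q\<close>, \<open>self_conj\<close>
    yields \<open>\<chi> x ^ (q + Q) = 1\<close>, and inverses of character values are
    conjugates.\<close>
  have "\<chi> x ^ q = cnj (\<chi> x ^ Q)" if x: "x \<in> carrier G" for x
  proof -
    obtain c where c: "Q = p ^ s * c" using k(1) by (auto simp: Q_def)
    have "\<chi> x ^ (p ^ s * (p ^ j + 1)) = 1"
      using self_conj[OF x] x by (simp flip: character_pow[OF \<chi>] add: character_one[OF \<chi>])
    hence "\<chi> x ^ (p ^ s * (p ^ j + 1) * c) = 1" by (simp only: power_mult power_one)
    also have "p ^ s * (p ^ j + 1) * c = q + Q"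
      unfolding q_def power_add Q_def[symmetric] c by (simp add: algebra_simps)
    finally have "\<chi> x ^ q * \<chi> x ^ Q = 1" by (simp add: power_add)
    moreover have "cnj (\<chi> x ^ Q) * \<chi> x ^ Q = 1"
      using character_mult_cnj[OF \<chi> x] by (simp add: mult.commute flip: power_mult_distrib)
    ultimately show ?thesis using character_nonzero[OF \<chi> x] by (metis mult_right_cancel power_not_zero)
  qed
  hence "(\<Sum>x\<in>carrier G. of_int (a x) * \<chi> x ^ q) = cnj \<eta>" by (simp add: \<eta>_def)
  hence "of_nat p advd S ^ q - cnj \<eta>"
    using frob[of 1 "j + k"] by (simp add: S_def charsum_def q_def)
  hence "1 - z advd S ^ q - cnj \<eta>" using pi_advd_p advd_trans by blast
  moreover have "1 - z advd cnj \<eta> - cnj S"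
    using pi_advd_cnj[OF advd_cong_sym[OF S\<eta>]] by simp
  ultimately have "1 - z advd S ^ q - cnj S" by (rule advd_cong_trans)
  \<comment> \<open>Multiplication by \<open>S\<close> brings in the norm, which vanishes modulo
    \<open>1 - z\<close>; hence a power of \<open>S\<close>, and with it one of
    \<open>\<eta>\<close>, vanishes too.\<close>
  hence "1 - z advd (S ^ q - cnj S) * S" using aS by (rule advd_mult)
  hence "1 - z advd S ^ Suc q - S * cnj S" by (simp add: algebra_simps)
  hence "1 - z advd S ^ Suc q" using norm advd_cong_sym advd_cong_0 unfolding S_def by blast
  moreover have "1 - z advd S ^ Suc q - \<eta> ^ Suc q" by (rule advd_cong_power[OF S\<eta> aS a\<eta>])
  ultimately have "1 - z advd \<eta> ^ Suc q" using advd_cong_0 by blast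
  \<comment> \<open>As \<open>p\<close> divides \<open>(1 - z) ^ (p ^ s)\<close>, nilpotency modulo
    \<open>1 - z\<close> becomes nilpotency modulo \<open>p\<close>.\<close>
  hence "(1 - z) ^ (p ^ s) advd (\<eta> ^ Suc q) ^ (p ^ s)" by (rule advd_power)
  hence nil: "of_nat p advd \<eta> ^ (Suc q * p ^ s)"
    using advd_one_minus_root_power[OF p z_pow(1)] advd_trans unfolding power_mult by blast
  \<comment> \<open>\<open>p ^ s\<close> divides \<open>Q\<close> and \<open>h\<close> divides
    \<open>Q - 1\<close>, so the group order divides \<open>Q * (Q - 1)\<close>. Thus the Frobenius
    power \<open>Q\<close> fixes \<open>\<eta>\<close> modulo \<open>p\<close>.\<close>
  have QQ: "\<chi> x ^ (Q * Q) = \<chi> x ^ Q" if x: "x \<in> carrier G" for x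
  proof -
    obtain c where c: "Q = p ^ s * c" using k(1) by (auto simp: Q_def)
    obtain c' where c': "Q - 1 = h * c'" using k(2) by (auto simp: Q_def)
    have "Q = Suc (Q - 1)" using k(3) by (simp add: Q_def)
    hence "Q * Q = Q + Q * (Q - 1)" by (metis mult_Suc_right)
    also have "Q * (Q - 1) = Coset.order G * (c * c')"
      unfolding c' order_G by (simp add: c)
    finally show ?thesis
      using character_root_unity[OF \<chi> x] by (simp add: power_add power_mult)
  qed
  have "(\<Sum>x\<in>carrier G. of_int (a x) * \<chi> x ^ (Q * Q)) = \<eta>" by (simp add: QQ \<eta>_def)
  hence \<eta>Q: "of_nat p advd \<eta> ^ Q - \<eta>"
    using frob[of Q k] by (simp only: \<eta>_def flip: Q_def)
  have \<eta>Qn: "of_nat p advd \<eta> ^ (Q ^ n) - \<eta>" for n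
  proof (induction n)
    case (Suc n)
    have "of_nat p advd (\<eta> ^ (Q ^ n)) ^ Q - \<eta> ^ Q"
      using Suc a\<eta> by (intro advd_cong_power algebraic_int_intros)
    from advd_cong_trans[OF this \<eta>Q] show ?case by (simp add: power_mult[symmetric] mult.commute)
  qed simp
  let ?m = "Suc q * p ^ s"
  \<comment> \<open>The estimate only ensures that the iterate \<open>\<eta> ^ (Q ^ ?m)\<close>,
    congruent to \<open>\<eta>\<close>, contains the nilpotent power \<open>\<eta> ^ ?m\<close> as a
    factor.\<close>
  have "2 ^ ?m \<le> Q ^ ?m" using k(3) by (intro power_mono) (auto simp: Q_def)
  hence "?m \<le> Q ^ ?m" using less_exp[of ?m] by linarith
  hence "\<eta> ^ (Q ^ ?m) = \<eta> ^ ?m * \<eta> ^ (Q ^ ?m - ?m)" by (simp flip: power_add)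
  hence "of_nat p advd \<eta> ^ (Q ^ ?m)" using nil a\<eta> by (simp only:) (intro advd_mult algebraic_int_intros)
  hence "of_nat p advd \<eta>" using \<eta>Qn advd_cong_0 by blast
  thus ?thesis by (simp add: \<eta>_def Q_def)
qed

end

text \<open>Take the \<open>h\<close>-th power of a character nontrivial at \<open>g\<close>. This
  removes the \<open>p\<close>-regular part, and \<open>g\<close> has order dividing
  \<open>p\<close>, prime to \<open>h\<close>, so the value at \<open>g\<close> stays
  nontrivial.\<close>

lemma ex_faithful_character:
  obtains \<chi> where "\<chi> \<in> characters G" "\<chi> g \<noteq> 1" "\<And>x. x \<in> carrier G \<Longrightarrow> \<chi> x ^ (p ^ s) = 1"
proof -
  have g: "g \<in> carrier G" using t by simp
  obtain \<chi> where \<chi>: "\<chi> \<in> characters G" "\<chi> g \<noteq> 1" using ex_character_neq_1[OF g t_pow'] by blast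
  have "g [^] p = \<one>" using t t_pow s by (cases s) (simp_all add: nat_pow_pow mult.commute)
  hence "\<chi> g ^ p = 1" using g by (simp flip: character_pow[OF \<chi>(1)] add: character_one[OF \<chi>(1)])
  hence "\<chi> g ^ h \<noteq> 1" using power_gcd_eq_1[of "\<chi> g" p h] coprime_ph \<chi>(2) by auto
  moreover have "(\<chi> x ^ h) ^ (p ^ s) = 1" if "x \<in> carrier G" for x
    using character_root_unity[OF \<chi>(1) that] by (simp add: order_G power_mult[symmetric] mult.commute)
  ultimately show ?thesis
    using that[OF characters_power[OF \<chi>(1), of h]] g by simp
qed

text \<open>Orbit sums of \<open>a\<close> are, up to the factor \<open>h\<close> prime to
  \<open>p\<close>, Fourier inversions over the characters trivial on \<open>T\<close>; each of
  those character sums is divisible by \<open>p\<close>.\<close>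

lemma p_dvd_orbit_sum:
  assumes norm: "\<And>\<chi>. \<chi> \<in> characters G \<Longrightarrow> \<chi> g \<noteq> 1 \<Longrightarrow>
      1 - cnj (\<chi> t) advd charsum \<chi> a * cnj (charsum \<chi> a)"
    and y: "y \<in> carrier G"
  shows "int p dvd (\<Sum>i<p ^ s. a (y \<otimes> t [^] i))"
proof -
  obtain k where k: "p ^ s dvd p ^ k" "h dvd p ^ k - 1" "p ^ k \<ge> 2"
    using ex_prime_power_cong_1[OF p coprime_ph h_pos] by blast
  obtain \<chi>0 where \<chi>0: "\<chi>0 \<in> characters G" "\<chi>0 g \<noteq> 1" "\<And>x. x \<in> carrier G \<Longrightarrow> \<chi>0 x ^ (p ^ s) = 1"
    using ex_faithful_character by blast
  have gT: "g \<in> T" using T_eq by auto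
  have p_dvd: "of_nat p advd charsum \<psi> a" if \<psi>: "\<psi> \<in> annihilator T" for \<psi>
  proof -
    have \<psi>': "\<psi> \<in> characters G" "\<And>x. x \<in> T \<Longrightarrow> \<psi> x = 1" using \<psi> by (auto simp: annihilator_def)
    \<comment> \<open>\<open>\<psi>\<close> is trivial at \<open>g\<close>, so \<open>norm\<close>
      does not apply to it. The twist by \<open>\<chi>0\<close> does satisfy the condition, and its
      \<open>p ^ k\<close>-th power is \<open>\<psi>\<close> again.\<close>
    let ?\<chi> = "\<lambda>x\<in>carrier G. \<psi> x * \<chi>0 x"
    have \<chi>: "?\<chi> \<in> characters G" using \<psi>'(1) \<chi>0(1) by (rule characters_mult)
    have \<chi>g: "?\<chi> g \<noteq> 1" using \<psi>'(2)[OF gT] \<chi>0(2) t by simp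
    have "?\<chi> x ^ (p ^ k) = \<psi> x" if x: "x \<in> carrier G" for x
    proof -
      obtain c where c: "p ^ k = p ^ s * c" using k(1) by auto
      obtain c' where c': "p ^ k - 1 = h * c'" using k(2) by auto
      have "\<psi> x ^ h = 1" using \<psi>'(2)[OF pow_h_mem_T[OF x]] x by (simp add: character_pow[OF \<psi>'(1)])
      hence "\<psi> x ^ (p ^ k - 1) = 1" unfolding c' power_mult by simp
      moreover have "p ^ k = Suc (p ^ k - 1)" using k(3) by simp
      ultimately have "\<psi> x ^ (p ^ k) = \<psi> x" by (metis mult_1_right power_Suc)
      moreover have "\<chi>0 x ^ (p ^ k) = 1" unfolding c power_mult using \<chi>0(3)[OF x] by simp
      ultimately show ?thesis using x by (simp add: power_mult_distrib)
    qed
    hence "(\<Sum>x\<in>carrier G. of_int (a x) * ?\<chi> x ^ (p ^ k)) = charsum \<psi> a"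
      unfolding charsum_def by (intro sum.cong) simp_all
    thus ?thesis using p_advd_twisted_charsum[OF \<chi> \<chi>g norm[OF \<chi> \<chi>g] k] by simp
  qed
  \<comment> \<open>The coset of \<open>T\<close> through \<open>y\<close>, that is its orbit under
    \<open>t\<close>; orthogonality over \<open>annihilator T\<close> cuts it out.\<close>
  let ?A = "{x \<in> carrier G. x \<otimes> inv y \<in> T}"
  have "card (annihilator T) = h"
    using card_annihilator[OF subgroup_T] p_pos by (simp add: card_T order_G)
  hence "(\<Sum>x\<in>carrier G. of_int (a x) * (\<Sum>\<psi>\<in>annihilator T. \<psi> (x \<otimes> inv y))) =
      (\<Sum>x\<in>carrier G. if x \<in> ?A then of_nat h * of_int (a x) else 0)"
    using y by (intro sum.cong) (simp_all add: sum_annihilator[OF subgroup_T])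
  also have "\<dots> = of_int (int h * (\<Sum>x\<in>?A. a x))"
    using fin by (simp add: sum.If_cases sum_distrib_left Int_def)
  finally have "of_int (int h * (\<Sum>x\<in>?A. a x)) =
      (\<Sum>x\<in>carrier G. of_int (a x) * (\<Sum>\<psi>\<in>annihilator T. \<psi> (x \<otimes> inv y)))" ..
  also have "\<dots> = (\<Sum>\<psi>\<in>annihilator T. \<Sum>x\<in>carrier G. of_int (a x) * \<psi> (x \<otimes> inv y))"
    unfolding sum_distrib_left by (rule sum.swap)
  also have "\<dots> = (\<Sum>\<psi>\<in>annihilator T. charsum \<psi> a * \<psi> (inv y))"
    unfolding charsum_def sum_distrib_right using y
    by (intro sum.cong refl) (simp add: annihilator_def character_mult)
  finally have "of_int (int p) advd of_int (int h * (\<Sum>x\<in>?A. a x))"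
    using p_dvd y by (auto intro!: advd_sum advd_mult algebraic_int_character simp: annihilator_def)
  hence "int p dvd int h * (\<Sum>x\<in>?A. a x)" by (simp only: of_int_advd_of_int_iff)
  hence "int p dvd (\<Sum>x\<in>?A. a x)"
    using coprime_ph by (simp add: coprime_dvd_mult_right_iff)
  moreover have "(\<Sum>i<p ^ s. a (y \<otimes> t [^] i)) = (\<Sum>x\<in>?A. a x)"
  proof (rule sum.reindex_bij_betw)
    show "bij_betw (\<lambda>i. y \<otimes> t [^] i) {..<p ^ s} ?A"
    proof (intro bij_betw_imageI inj_onI)
      fix i k assume "i \<in> {..<p ^ s}" "k \<in> {..<p ^ s}" "y \<otimes> t [^] i = y \<otimes> t [^] k"
      thus "i = k" using y t by (simp add: t_pow_eq_iff cong_def)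
    next
      show "(\<lambda>i. y \<otimes> t [^] i) ` {..<p ^ s} = ?A"
      proof (intro equalityI subsetI)
        fix x assume "x \<in> (\<lambda>i. y \<otimes> t [^] i) ` {..<p ^ s}"
        then obtain i where i: "x = y \<otimes> t [^] (i::nat)" by auto
        hence "x \<otimes> inv y = t [^] i" using y t by (simp add: m_comm[of y] m_assoc)
        thus "x \<in> ?A" using i y t T_eq by auto
      next
        fix x assume x: "x \<in> ?A"
        then obtain i where "x \<otimes> inv y = t [^] (i::nat)" using T_eq by auto
        moreover have "t [^] i = t [^] (i mod p ^ s)" by (simp add: t_pow_eq_iff)
        moreover have "x = (x \<otimes> inv y) \<otimes> y" using x y by (simp add: m_assoc)
        ultimately have "x = y \<otimes> t [^] (i mod p ^ s)"
          using y t by (metis m_comm nat_pow_closed)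
        thus "x \<in> (\<lambda>i. y \<otimes> t [^] i) ` {..<p ^ s}" using p_pos by auto
      qed
    qed
  qed
  ultimately show ?thesis by simp
qed

section \<open>Descent through powers of the difference operator\<close>

text \<open>In each step the norm of \<open>charsum \<chi> b\<close> is still divisible by
  \<open>1 - cnj (\<chi> t)\<close>, because \<open>r\<close> is below the power of it that divides
  \<open>p\<close>. Then \<open>b\<close> is itself a difference modulo \<open>p\<close>.\<close>

lemma cong_diff_pow:
  assumes norm: "\<And>\<chi>. \<chi> \<in> characters G \<Longrightarrow> \<chi> g \<noteq> 1 \<Longrightarrow>
      of_nat (p ^ 2) advd charsum \<chi> a * cnj (charsum \<chi> a)"
    and "r \<le> p ^ s - p ^ (s - 1)"
  shows "\<exists>b. \<forall>x\<in>carrier G. int p dvd a x - (diff ^^ r) b x"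
  using assms(2)
proof (induction r)
  case 0
  show ?case by (intro exI[of _ a]) simp
next
  case (Suc r)
  define f where "f = p ^ s - p ^ (s - 1)"
  obtain b where b: "\<And>x. x \<in> carrier G \<Longrightarrow> int p dvd a x - (diff ^^ r) b x" using Suc by auto
  define c where "c = (\<lambda>x. (a x - (diff ^^ r) b x) div int p)"
  have c: "a x = (diff ^^ r) b x + int p * c x" if "x \<in> carrier G" for x
    using b[OF that] by (simp add: c_def)
  have "1 - cnj (\<chi> t) advd charsum \<chi> b * cnj (charsum \<chi> b)"
    if \<chi>: "\<chi> \<in> characters G" "\<chi> g \<noteq> 1" for \<chi>
  proof -
    define \<pi> where "\<pi> = 1 - cnj (\<chi> t)"
    have \<pi>0: "\<pi> \<noteq> 0" using z_neq_1[OF \<chi>] by (simp add: \<pi>_def)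
    have a\<pi>: "algebraic_int \<pi>"
      unfolding \<pi>_def using algebraic_int_z[OF \<chi>] by (intro algebraic_int_diff) auto
    obtain u where u: "algebraic_int u" "of_nat p = \<pi> ^ f * u"
      using power_one_minus_root_advd_prime[OF p s z_pow[OF \<chi>]] by (auto simp: alg_dvd_def f_def \<pi>_def)
    define m where "m = f - r"
    have m: "m > 0" "f = r + m" using Suc.prems by (auto simp: m_def f_def)
    \<comment> \<open>The quotient of \<open>charsum \<chi> a\<close> by \<open>\<pi> ^ r\<close>;
      since \<open>m > 0\<close>, it is congruent to \<open>charsum \<chi> b\<close> modulo
      \<open>\<pi>\<close>.\<close>
    define y where "y = charsum \<chi> b + \<pi> ^ m * u * charsum \<chi> c"
    have ay: "algebraic_int y" unfolding y_def
      by (intro algebraic_int_intros a\<pi> u algebraic_int_charsum \<chi>)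
    have "charsum \<chi> a = charsum \<chi> ((diff ^^ r) b) + of_nat p * charsum \<chi> c"
      unfolding charsum_def sum_distrib_left sum.distrib[symmetric]
      by (intro sum.cong) (simp_all add: c algebra_simps)
    also have "\<dots> = \<pi> ^ r * y"
      unfolding charsum_diff_pow[OF \<chi>(1)] y_def u(2) m(2) by (simp add: \<pi>_def power_add algebra_simps)
    finally have Sa: "charsum \<chi> a = \<pi> ^ r * y" .
    obtain e where e: "algebraic_int e" "charsum \<chi> a * cnj (charsum \<chi> a) = of_nat (p ^ 2) * e"
      using norm[OF \<chi>] by (auto simp: alg_dvd_def)
    \<comment> \<open>\<open>p\<close> is real, so \<open>p ^ 2\<close> is \<open>p\<close> times
      its conjugate. This supplies both \<open>\<pi> ^ f\<close> and \<open>cnj \<pi> ^ f\<close>;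
      cancelling the \<open>r\<close>-th powers leaves \<open>\<pi> ^ m\<close>.\<close>
    have "(\<pi> ^ r * cnj \<pi> ^ r) * (y * cnj y) = of_nat p * cnj (of_nat p) * e"
      using e(2) unfolding Sa by (simp add: power2_eq_square algebra_simps)
    also have "\<dots> = (\<pi> ^ r * cnj \<pi> ^ r) * (\<pi> ^ m * (cnj \<pi> ^ m * u * cnj u * e))"
      unfolding u(2) m(2) by (simp add: power_add algebra_simps)
    finally have "y * cnj y = \<pi> ^ m * (cnj \<pi> ^ m * u * cnj u * e)" using \<pi>0 by simp
    moreover have "\<pi> advd \<pi> ^ m" using m(1) a\<pi> by (intro advd_power_gt_0 advd_refl)
    moreover have "algebraic_int (cnj \<pi> ^ m * u * cnj u * e)"
      using a\<pi> u e by (intro algebraic_int_intros) auto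
    ultimately have yy: "\<pi> advd y * cnj y" by (simp add: advd_mult)
    have "\<pi> advd \<pi> ^ m * (u * charsum \<chi> c)"
      using \<open>\<pi> advd \<pi> ^ m\<close> by (intro advd_mult algebraic_int_intros u algebraic_int_charsum \<chi>)
    hence yS: "\<pi> advd y - charsum \<chi> b" by (simp add: y_def mult.assoc)
    hence yS': "\<pi> advd cnj y - cnj (charsum \<chi> b)"
      using pi_advd_cnj[OF \<chi>] unfolding \<pi>_def by (metis complex_cnj_diff)
    have "\<pi> advd (y - charsum \<chi> b) * cnj y + charsum \<chi> b * (cnj y - cnj (charsum \<chi> b))"
      using ay by (intro advd_add advd_mult[OF yS] advd_mult'[OF yS'] algebraic_int_charsum \<chi>) auto
    hence "\<pi> advd y * cnj y - charsum \<chi> b * cnj (charsum \<chi> b)" by (simp add: algebra_simps)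
    thus ?thesis using yy advd_cong_0 unfolding \<pi>_def by blast
  qed
  from ex_diff_cong[OF p_dvd_orbit_sum[OF this]] obtain b' where
    b': "\<And>x. x \<in> carrier G \<Longrightarrow> int p dvd b x - diff b' x" by blast
  have "int p dvd a x - (diff ^^ Suc r) b' x" if "x \<in> carrier G" for x
    using dvd_add[OF b[OF that] diff_pow_cong[of "int p" b "diff b'" x r, OF b' that]]
    by (simp add: funpow_swap1)
  thus ?case by blast
qed

lemma cong_shift_mod_p:
  assumes norm: "\<And>\<chi>. \<chi> \<in> characters G \<Longrightarrow> \<chi> g \<noteq> 1 \<Longrightarrow>
      of_nat (p ^ 2) advd charsum \<chi> a * cnj (charsum \<chi> a)"
    and x: "x \<in> carrier G"
  shows "int p dvd a x - a (x \<otimes> g)"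
proof -
  let ?f = "p ^ s - p ^ (s - 1)"
  obtain b where b: "\<And>x. x \<in> carrier G \<Longrightarrow> int p dvd a x - (diff ^^ ?f) b x"
    using cong_diff_pow[OF norm order_refl] by blast
  have le: "p ^ (s - 1) \<le> p ^ s" using p_pos by (intro power_increasing) auto
  have 1: "int p dvd (a x - (diff ^^ ?f) b x) - (a (x \<otimes> g) - (diff ^^ ?f) b (x \<otimes> g))"
    using x t by (intro dvd_diff b) auto
  have 2: "int p dvd (diff ^^ (p ^ (s - 1))) ((diff ^^ ?f) b) x - ((diff ^^ ?f) b x - (diff ^^ ?f) b (x \<otimes> g))"
    by (rule diff_prime_power_cong[OF x])
  have 3: "int p dvd (diff ^^ (p ^ s)) b x - (b x - b (x \<otimes> t [^] (p ^ s)))"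
    by (rule diff_prime_power_cong[OF x])
  \<comment> \<open>The exponents add up to \<open>p ^ s\<close>, and shifting by
    \<open>t [^] (p ^ s)\<close> is the identity, so the \<open>b\<close> terms in the last bracket
    cancel.\<close>
  have "(diff ^^ (p ^ (s - 1))) ((diff ^^ ?f) b) = (diff ^^ (p ^ s)) b"
    using le by (simp flip: funpow_add[unfolded comp_def fun_eq_iff, rule_format])
  hence "a x - a (x \<otimes> g) =
      ((a x - (diff ^^ ?f) b x) - (a (x \<otimes> g) - (diff ^^ ?f) b (x \<otimes> g)))
    - ((diff ^^ (p ^ (s - 1))) ((diff ^^ ?f) b) x - ((diff ^^ ?f) b x - (diff ^^ ?f) b (x \<otimes> g)))
    + ((diff ^^ (p ^ s)) b x - (b x - b (x \<otimes> t [^] (p ^ s))))"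
    using x t_pow by simp
  thus ?thesis using 1 2 3 by (simp only: dvd_add dvd_diff)
qed

text \<open>Induction by dividing by \<open>p\<close>: the residues of \<open>a\<close> modulo
  \<open>p\<close> are invariant under \<open>g\<close>, so they contribute nothing to the sums for
  characters nontrivial at \<open>g\<close>, and the quotient \<open>b\<close> inherits the norm
  condition with \<open>p ^ (2 * d)\<close>.\<close>

lemma cong_shift:
  assumes "\<And>\<chi>. \<chi> \<in> characters G \<Longrightarrow> \<chi> g \<noteq> 1 \<Longrightarrow>
      of_nat (p ^ (2 * d)) advd charsum \<chi> a * cnj (charsum \<chi> a)"
    and x: "x \<in> carrier G"
  shows "int (p ^ d) dvd a x - a (x \<otimes> g)"
  using assms(1)
proof (induction d arbitrary: a)
  case (Suc d)
  define b where "b = (\<lambda>x. a x div int p)"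
  have p2: "of_nat (p ^ 2) advd charsum \<chi> a * cnj (charsum \<chi> a)"
    if "\<chi> \<in> characters G" "\<chi> g \<noteq> 1" for \<chi>
  proof -
    have "of_nat (p ^ 2) advd of_nat (p ^ (2 * Suc d))"
    proof (rule advdI)
      have "2 * Suc d = 2 + 2 * d" by simp
      hence "p ^ (2 * Suc d) = p ^ 2 * p ^ (2 * d)" by (simp only: power_add)
      thus "of_nat (p ^ (2 * Suc d)) = of_nat (p ^ 2) * (of_nat (p ^ (2 * d)) :: complex)"
        by (simp only: of_nat_mult)
    qed (rule algebraic_int_of_nat)
    thus ?thesis using Suc.prems[OF that] advd_trans by blast
  qed
  have mod_eq: "a (x \<otimes> g) mod int p = a x mod int p" if "x \<in> carrier G" for x
  proof -
    have "int p dvd a x - a (x \<otimes> g)" by (rule cong_shift_mod_p[OF p2 that])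
    thus ?thesis by (metis mod_eq_dvd_iff)
  qed
  have "of_nat (p ^ (2 * d)) advd charsum \<chi> b * cnj (charsum \<chi> b)"
    if \<chi>: "\<chi> \<in> characters G" "\<chi> g \<noteq> 1" for \<chi>
  proof -
    have "charsum \<chi> (\<lambda>x. a x mod int p) = 0"
      using charsum_invariant[OF \<chi>(1) _ \<chi>(2)] t mod_eq by simp
    moreover have "of_int (a x) = of_nat p * of_int (b x) + (of_int (a x mod int p) :: complex)" for x
    proof -
      have "a x = int p * b x + a x mod int p" by (simp add: b_def)
      thus ?thesis by (metis of_int_add of_int_mult of_int_of_nat_eq)
    qed
    hence "charsum \<chi> a = of_nat p * charsum \<chi> b + charsum \<chi> (\<lambda>x. a x mod int p)"
      unfolding charsum_def sum_distrib_left sum.distrib[symmetric]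
      by (intro sum.cong) (simp_all add: algebra_simps)
    ultimately have S: "charsum \<chi> a = of_nat p * charsum \<chi> b" by simp
    obtain e where e: "algebraic_int e" "charsum \<chi> a * cnj (charsum \<chi> a) = of_nat (p ^ (2 * Suc d)) * e"
      using Suc.prems[OF \<chi>] by (auto simp: alg_dvd_def)
    have "of_nat p * of_nat p * (charsum \<chi> b * cnj (charsum \<chi> b)) =
        of_nat p * of_nat p * (of_nat (p ^ (2 * d)) * e)"
      using e(2) unfolding S by (simp add: algebra_simps)
    hence "charsum \<chi> b * cnj (charsum \<chi> b) = of_nat (p ^ (2 * d)) * e" using p_pos by simp
    with e(1) show ?thesis by (rule advdI)
  qed
  hence "int (p ^ d) dvd b x - b (x \<otimes> g)" by (rule Suc.IH)
  hence "int p * int (p ^ d) dvd int p * (b x - b (x \<otimes> g))" by (rule mult_dvd_mono[OF dvd_refl])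
  moreover have "a x = int p * b x + a x mod int p" "a (x \<otimes> g) = int p * b (x \<otimes> g) + a (x \<otimes> g) mod int p"
    by (simp_all add: b_def)
  hence "int p * (b x - b (x \<otimes> g)) = a x - a (x \<otimes> g)"
    using mod_eq[OF x] by (simp add: right_diff_distrib)
  ultimately show ?case by (simp only: power_Suc of_nat_mult)
qed simp

end

section \<open>Characters and the group ring\<close>

lemma char_extend_superset:
  assumes "finite S" "Poly_Mapping.keys x \<subseteq> S"
  shows "char_extend \<chi> x = (\<Sum>a\<in>S. of_int (Poly_Mapping.lookup x a) * \<chi> a)"
  unfolding char_extend_def using assms
  by (intro sum.mono_neutral_left) (auto simp: in_keys_iff)

lemma char_extend_0: "char_extend \<chi> 0 = 0"
  by (simp add: char_extend_def)

lemma char_extend_frag_of: "char_extend \<chi> (frag_of a) = \<chi> a"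
  by (simp add: char_extend_def)

lemma char_extend_cmul: "char_extend \<chi> (frag_cmul c x) = of_int c * char_extend \<chi> x"
proof -
  have "char_extend \<chi> (frag_cmul c x) = (\<Sum>a\<in>Poly_Mapping.keys x. of_int c * (of_int (Poly_Mapping.lookup x a) * \<chi> a))"
    by (subst char_extend_superset[OF _ keys_cmul]) (simp_all add: mult.assoc)
  thus ?thesis by (simp add: char_extend_def sum_distrib_left)
qed

lemma char_extend_add: "char_extend \<chi> (x + y) = char_extend \<chi> x + char_extend \<chi> y"
proof -
  let ?S = "Poly_Mapping.keys x \<union> Poly_Mapping.keys y"
  have "char_extend \<chi> (x + y) = (\<Sum>a\<in>?S. of_int (Poly_Mapping.lookup (x + y) a) * \<chi> a)"
    by (intro char_extend_superset keys_add) auto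
  also have "\<dots> = (\<Sum>a\<in>?S. of_int (Poly_Mapping.lookup x a) * \<chi> a)
      + (\<Sum>a\<in>?S. of_int (Poly_Mapping.lookup y a) * \<chi> a)"
    by (simp add: lookup_add algebra_simps sum.distrib)
  also have "\<dots> = char_extend \<chi> x + char_extend \<chi> y"
    by (subst (1 2) char_extend_superset[where S = ?S]) auto
  finally show ?thesis .
qed

lemma char_extend_diff: "char_extend \<chi> (x - y) = char_extend \<chi> x - char_extend \<chi> y"
  using char_extend_add[of \<chi> "x - y" y] by simp

lemma char_extend_sum: "char_extend \<chi> (\<Sum>i\<in>A. f i) = (\<Sum>i\<in>A. char_extend \<chi> (f i))"
  by (induction A rule: infinite_finite_induct) (auto simp: char_extend_0 char_extend_add)

lemma char_extend_gr_set: "char_extend \<chi> (gr_set A) = sum \<chi> A"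
  by (simp add: gr_set_def char_extend_sum char_extend_frag_of)

lemma char_extend_frag_extend:
  "char_extend \<chi> (frag_extend f x) =
    (\<Sum>a\<in>Poly_Mapping.keys x. of_int (Poly_Mapping.lookup x a) * char_extend \<chi> (f a))"
  by (simp add: frag_extend_def char_extend_sum char_extend_cmul)

lemma keys_sum_frag_of: "Poly_Mapping.keys (\<Sum>a\<in>A. frag_of (f a)) \<subseteq> f ` A"
  by (induction A rule: infinite_finite_induct) (auto dest: subsetD[OF keys_add])

context finite_comm_group
begin

lemma char_extend_gr_mult:
  assumes \<chi>: "\<chi> \<in> characters G"
    and "Poly_Mapping.keys x \<subseteq> carrier G" "Poly_Mapping.keys y \<subseteq> carrier G"
  shows "char_extend \<chi> (gr_mult G x y) = char_extend \<chi> x * char_extend \<chi> y"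
proof -
  have "char_extend \<chi> (frag_extend (\<lambda>b. frag_of (a \<otimes> b)) y) = \<chi> a * char_extend \<chi> y"
    if "a \<in> Poly_Mapping.keys x" for a
  proof -
    have "\<chi> (a \<otimes> b) = \<chi> a * \<chi> b" if "b \<in> Poly_Mapping.keys y" for b
      using \<open>a \<in> Poly_Mapping.keys x\<close> that assms by (intro character_mult) auto
    thus ?thesis
      unfolding char_extend_frag_extend char_extend_frag_of
      by (subst char_extend_def) (auto simp: sum_distrib_left mult_ac intro!: sum.cong)
  qed
  thus ?thesis
    unfolding gr_mult_def char_extend_frag_extend
    by (subst (2) char_extend_def) (auto simp: sum_distrib_right mult.assoc intro!: sum.cong)
qed

text \<open>Applying \<open>\<chi>\<close> to the defining equation makes the value at
  \<open>D j\<close> a factor of \<open>- l\<close>, because \<open>\<chi>\<close> sums to 0 over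
  the group.\<close>

lemma SEDF_character_neq_0:
  assumes "SEDF G v m k l D" "\<chi> \<in> characters G" "\<chi> \<noteq> principal_character G" "j \<in> {1..m}"
  shows "char_extend \<chi> (gr_set (D j)) \<noteq> 0"
proof
  assume 0: "char_extend \<chi> (gr_set (D j)) = 0"
  define Y where "Y = (\<Sum>i\<in>{1..m} - {j}. gr_set_inv G (D i))"
  have sub: "\<And>i. i \<in> {1..m} \<Longrightarrow> D i \<subseteq> carrier G" and l: "l \<ge> 1"
    and eq: "gr_mult G (gr_set (D j)) Y = frag_cmul (int l) (gr_set (carrier G) - frag_of \<one>)"
    using assms(1,4) unfolding SEDF_def Y_def by auto
  have "Poly_Mapping.keys (gr_set_inv G (D i)) \<subseteq> carrier G" if "i \<in> {1..m}" for i
    using keys_sum_frag_of[of "\<lambda>a. inv a" "D i"] sub[OF that]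
    unfolding gr_set_inv_def by auto
  hence "Poly_Mapping.keys Y \<subseteq> carrier G"
    unfolding Y_def by (intro order.trans[OF keys_sum] UN_least) auto
  moreover have "Poly_Mapping.keys (gr_set (D j)) \<subseteq> carrier G"
    using keys_sum_frag_of[of "\<lambda>a. a" "D j"] sub[OF assms(4)] unfolding gr_set_def by auto
  ultimately have "char_extend \<chi> (gr_mult G (gr_set (D j)) Y) = 0"
    using 0 assms(2) by (simp add: char_extend_gr_mult)
  moreover have "char_extend \<chi> (frag_cmul (int l) (gr_set (carrier G) - frag_of \<one>)) = - of_nat l"
    using assms(2,3)
    by (simp add: char_extend_cmul char_extend_diff char_extend_gr_set char_extend_frag_of
        sum_character_eq_0 character_one)
  ultimately show False using l unfolding eq by simp
qed

section \<open>Reduction to a quotient with cyclic Sylow subgroup\<close>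

lemma card_set_mult_subgroups:
  assumes H: "subgroup H G" and K: "subgroup K G" and HK: "H \<inter> K = {\<one>}"
  shows "card (H <#> K) = card H * card K"
proof -
  interpret H: subgroup H G by (rule H)
  interpret K: subgroup K G by (rule K)
  have "bij_betw (\<lambda>(x, y). x \<otimes> y) (H \<times> K) (H <#> K)"
  proof (intro bij_betw_imageI inj_onI)
    fix a b assume "a \<in> H \<times> K" "b \<in> H \<times> K" and eq: "(\<lambda>(x, y). x \<otimes> y) a = (\<lambda>(x, y). x \<otimes> y) b"
    then obtain x y x' y' where *: "a = (x, y)" "b = (x', y')" "x \<in> H" "x' \<in> H" "y \<in> K" "y' \<in> K"
      by auto
    have c: "x \<in> carrier G" "x' \<in> carrier G" "y \<in> carrier G" "y' \<in> carrier G"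
      using * H.subset K.subset by auto
    have "x \<otimes> y = x' \<otimes> y'" using eq * by simp
    hence "inv x' \<otimes> (x \<otimes> y) \<otimes> inv y = inv x' \<otimes> (x' \<otimes> y') \<otimes> inv y" by simp
    hence e: "inv x' \<otimes> x = y' \<otimes> inv y" using c by (simp add: m_assoc flip: m_assoc[of "inv x'" x' y'])
    moreover have "inv x' \<otimes> x \<in> H" "y' \<otimes> inv y \<in> K" using * by auto
    ultimately have "inv x' \<otimes> x = \<one>" "y' \<otimes> inv y = \<one>" using HK by auto
    hence "x = x'" "y = y'" using c
      by (metis inv_closed inv_equality inv_inv m_comm)+
    thus "a = b" using * by simp
  qed (auto simp: set_mult_def)
  from bij_betw_same_card[OF this] show ?thesis by (simp add: card_cartesian_product)
qed

lemma subgroup_exponent_power: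
  assumes P: "subgroup P G" "card P = p ^ b" and p: "prime p" and b: "b > 0"
  obtains s t where "s > 0" "group_exponent (G\<lparr>carrier := P\<rparr>) = p ^ s"
    "\<And>x. x \<in> P \<Longrightarrow> x [^] (p ^ s) = \<one>" "t \<in> P" "t [^] (p ^ (s - 1)) \<noteq> \<one>"
proof -
  interpret P: subgroup P G by (rule P(1))
  interpret PG: group "G\<lparr>carrier := P\<rparr>" by (rule subgroup.subgroup_is_group[OF P(1)]) (rule group_axioms)
  define e where "e = group_exponent (G\<lparr>carrier := P\<rparr>)"
  have e_def': "e = (LEAST n. n > 0 \<and> (\<forall>x\<in>P. x [^] n = \<one>))"
    by (simp add: e_def group_exponent_def nat_pow_consistent[symmetric])
  have p1: "p > 1" using p by (rule prime_gt_1_nat)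
  have "x [^] (p ^ b) = \<one>" if "x \<in> P" for x
    using PG.pow_order_eq_1[of x] that P(2) by (simp add: Coset.order_def nat_pow_consistent[symmetric])
  hence pb: "p ^ b > 0 \<and> (\<forall>x\<in>P. x [^] (p ^ b) = \<one>)" using p1 by auto
  from LeastI[of "\<lambda>n. n > 0 \<and> (\<forall>x\<in>P. x [^] n = \<one>)", OF this]
  have e: "e > 0" "\<And>x. x \<in> P \<Longrightarrow> x [^] e = \<one>" unfolding e_def' by auto
  have least: "\<exists>x\<in>P. x [^] n \<noteq> \<one>" if "0 < n" "n < e" for n
    using not_less_Least[of n "\<lambda>n. n > 0 \<and> (\<forall>x\<in>P. x [^] n = \<one>)"] that unfolding e_def'[symmetric] by auto
  have "e dvd p ^ b"
  proof (rule ccontr)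
    assume "\<not> e dvd p ^ b"
    \<comment> \<open>By minimality of \<open>e\<close> the smaller remainder cannot annihilate
      \<open>P\<close>, yet it is a multiple of every element order in \<open>P\<close>.\<close>
    hence "0 < p ^ b mod e" "p ^ b mod e < e" using e(1) by (auto simp: mod_greater_zero_iff_not_dvd)
    then obtain x where x: "x \<in> P" "x [^] (p ^ b mod e) \<noteq> \<one>" using least by blast
    have xc: "x \<in> carrier G" using x P.subset by auto
    have "ord x dvd p ^ b" "ord x dvd e" using pb e(2) x(1) xc by (auto simp: pow_eq_id)
    hence "ord x dvd p ^ b mod e" by (simp add: dvd_mod)
    with x(2) xc show False by (simp add: pow_eq_id)
  qed
  then obtain s where s: "e = p ^ s" using divides_primepow_nat[OF p] by blast
  have s0: "s > 0"
  proof (rule ccontr)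
    assume "\<not> s > 0"
    hence "P = {\<one>}" using e(2) s P.subset by force
    hence "p ^ b = 1" using P(2) by simp
    thus False using p1 b by simp
  qed
  have "p ^ (s - 1) < e" using s0 p1 unfolding s by (intro power_strict_increasing) auto
  then obtain t where "t \<in> P" "t [^] (p ^ (s - 1)) \<noteq> \<one>"
    using least[of "p ^ (s - 1)"] p1 by auto
  thus ?thesis using that[of s t] s0 s e(2) by (simp add: e_def)
qed

text \<open>\<open>P\<close> is the direct product of a cyclic subgroup of maximal order and the
  kernel \<open>W\<close> of a character on \<open>P\<close>. Dividing by \<open>U\<close> and
  \<open>W\<close> leaves the cyclic factor intact.\<close>

lemma ex_cyclic_sylow_quotient:
  assumes p: "prime p" "p dvd Coset.order G" and P: "sylow_subgroup p P G"
    and U: "subgroup U G" "U \<inter> P = {\<one>}"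
    and sc: "self_conjugate p (group_exponent (G Mod U))"
  obtains N s h j t where "subgroup N G" "t \<in> carrier G"
    "cyclic_sylow (G Mod N) p s h j (N #> t)"
    "card N * p ^ s = card U * card P" "p ^ s = group_exponent (G\<lparr>carrier := P\<rparr>)"
proof -
  define b where "b = multiplicity p (Coset.order G)"
  have sP: "subgroup P G" and cP: "card P = p ^ b" using P by (auto simp: sylow_subgroup_def b_def)
  interpret U: subgroup U G by (rule U(1))
  interpret P: subgroup P G by (rule sP)
  have p1: "p > 1" using p(1) by (rule prime_gt_1_nat)
  obtain h0 where h0: "Coset.order G = p ^ b * h0" "\<not> p dvd h0"
    using multiplicity_decompose'[of "Coset.order G" p] order_pos p1 unfolding b_def by auto
  have b0: "b > 0" using p h0 order_pos by (cases b) auto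
  obtain s t where s: "s > 0" "group_exponent (G\<lparr>carrier := P\<rparr>) = p ^ s"
    and exp: "\<And>x. x \<in> P \<Longrightarrow> x [^] (p ^ s) = \<one>"
    and t: "t \<in> P" "t [^] (p ^ (s - 1)) \<noteq> \<one>"
    using subgroup_exponent_power[OF sP cP p(1) b0] by blast
  have tG: "t \<in> carrier G" using t(1) P.subset by auto
  obtain \<chi> where \<chi>: "\<chi> \<in> characters G" "\<chi> (t [^] (p ^ (s - 1))) \<noteq> 1"
    using ex_character_neq_1[OF _ t(2)] tG by auto
  define z where "z = \<chi> t"
  have z: "z ^ (p ^ s) = 1" "z ^ (p ^ (s - 1)) \<noteq> 1"
    using \<chi>(2) exp[OF t(1)] tG
    by (auto simp: z_def character_one[OF \<chi>(1)] simp flip: character_pow[OF \<chi>(1)])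
  note prim = primitive_root_prime_power[OF p(1) z]
  \<comment> \<open>A complement to the subgroup generated by \<open>t\<close> in \<open>P\<close>:
    the values of \<open>\<chi>\<close> on \<open>P\<close> are \<open>p ^ s\<close>-th roots of
    unity, and \<open>\<chi> t\<close> is a primitive one.\<close>
  define W where "W = {x \<in> P. \<chi> x = 1}"
  have "\<one> \<in> W" using P.one_closed by (simp add: W_def character_one[OF \<chi>(1)])
  hence sW: "subgroup W G"
    using P.subset
    by (intro subgroupI)
      (auto simp: W_def character_mult[OF \<chi>(1)] character_inv[OF \<chi>(1)] intro!: exI[of _ \<one>])
  let ?T = "generate G {t}"
  have sT: "subgroup ?T G" using tG by (intro generate_is_subgroup) auto
  have ord_t: "ord t = p ^ s" by (rule ord_eq_prime_power[OF p(1) tG exp[OF t(1)] t(2)])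
  have T_eq: "?T = {t [^] i | i :: nat. i \<in> UNIV}"
    using generate_pow_nat[OF tG] ord_t p1 by simp
  have TP: "t [^] i \<in> P" for i :: nat using t(1) by (induction i) auto
  have "W \<inter> ?T = {\<one>}"
  proof (intro equalityI subsetI)
    fix x assume x: "x \<in> W \<inter> ?T"
    then obtain i :: nat where i: "x = t [^] i" using T_eq by auto
    have "z ^ i = 1" using x i tG by (simp add: W_def z_def character_pow[OF \<chi>(1)])
    hence "z ^ (i mod p ^ s) = 1"
      using z(1) by (metis div_mult_mod_eq mult.commute mult_1 power_add power_mult power_one)
    hence "i mod p ^ s = 0" using prim[of "i mod p ^ s"] p1 by auto
    hence "t [^] i = \<one>" using ord_t tG by (simp add: pow_eq_id dvd_eq_mod_eq_0)
    thus "x \<in> {\<one>}" using i by simp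
  qed (use subgroup.one_closed[OF sW] subgroup.one_closed[OF sT] in auto)
  moreover have "W <#> ?T = P"
  proof (intro equalityI subsetI)
    fix x assume "x \<in> W <#> ?T"
    thus "x \<in> P" using TP T_eq by (auto simp: set_mult_def W_def)
  next
    fix x assume x: "x \<in> P"
    hence xG: "x \<in> carrier G" using P.subset by auto
    have "\<chi> x ^ (p ^ s) = 1"
      using exp[OF x] xG by (simp add: character_one[OF \<chi>(1)] flip: character_pow[OF \<chi>(1)])
    \<comment> \<open>The powers of \<open>z\<close> exhaust these roots of unity, so dividing
      \<open>x\<close> by a suitable power of \<open>t\<close> moves it into
      \<open>W\<close>.\<close>
    hence "\<chi> x \<in> (\<lambda>k. z ^ k) ` {..<p ^ s}"
      using powers_primitive_root(2)[OF _ z(1) prim] p1 by simp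
    then obtain i where "\<chi> x = z ^ i" by auto
    hence "\<chi> (x \<otimes> inv (t [^] i)) = 1"
      using xG tG character_mult_cnj[OF \<chi>(1), of "t [^] i"]
      by (simp add: character_mult[OF \<chi>(1)] character_inv[OF \<chi>(1)] character_pow[OF \<chi>(1)] z_def)
    hence "x \<otimes> inv (t [^] i) \<in> W" using x TP by (simp add: W_def)
    moreover have "x = (x \<otimes> inv (t [^] i)) \<otimes> t [^] i" using xG tG by (simp add: m_assoc)
    ultimately show "x \<in> W <#> ?T" using T_eq unfolding set_mult_def by blast
  qed
  ultimately have cW: "card P = card W * p ^ s"
    using card_set_mult_subgroups[OF sW sT] generate_pow_card[OF tG] ord_t by simp
  define N where "N = U <#> W"
  have sN: "subgroup N G" unfolding N_def by (rule mult_subgroups[OF U(1) sW])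
  have "U \<inter> W = {\<one>}" using U(2) subgroup.one_closed[OF sW] U.one_closed by (auto simp: W_def)
  hence cN: "card N * p ^ s = card U * card P"
    using card_set_mult_subgroups[OF U(1) sW] cW by (simp add: N_def)
  \<comment> \<open>As \<open>U\<close> and \<open>P\<close> meet trivially,
    \<open>card U * p ^ b\<close> divides the group order, so \<open>card U\<close> divides its
    \<open>p\<close>-free part \<open>h0\<close>.\<close>
  have "card (U <#> P) dvd Coset.order G"
    using lagrange[OF mult_subgroups[OF U(1) sP]] by (metis dvd_triv_right)
  hence "p ^ b * card U dvd p ^ b * h0"
    using card_set_mult_subgroups[OF U(1) sP U(2)] h0 cP by (simp add: mult.commute)
  hence "card U dvd h0" using p1 by simp
  then obtain h where h: "h0 = card U * h" by blast
  have "\<not> p dvd h" using h0 h by auto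
  hence coprime: "coprime p h" using p(1) by (simp add: prime_imp_coprime)
  interpret Q: finite_comm_group "G Mod N" using sN by (rule quotient_finite_comm_group)
  interpret N: normal N G using sN by (rule subgroup_imp_normal)
  have "U \<subseteq> N"
  proof
    fix u assume "u \<in> U"
    hence "u = u \<otimes> \<one>" using U.subset by auto
    thus "u \<in> N" using \<open>u \<in> U\<close> subgroup.one_closed[OF sW] unfolding N_def set_mult_def by blast
  qed
  have N_iff: "(N #> x) [^]\<^bsub>G Mod N\<^esub> n = \<one>\<^bsub>G Mod N\<^esub> \<longleftrightarrow> x [^] n \<in> N" if "x \<in> carrier G" for x and n :: nat
  proof -
    have xn: "x [^] n \<in> carrier G" using that by simp
    have "N #> (x [^] n) = N \<longleftrightarrow> x [^] n \<in> N"
      using coset_join1[OF _ xn sN] coset_join2[OF xn sN] by blast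
    thus ?thesis using N.FactGroup_pow[OF that, of n] by simp
  qed
  have order_Q: "Coset.order (G Mod N) = p ^ s * h"
  proof -
    have "card (rcosets N) * card N * p ^ s = p ^ b * h0 * p ^ s"
      using lagrange[OF sN] h0 by simp
    also have "\<dots> = card N * p ^ s * (p ^ s * h)" using h cN cP by (simp add: mult_ac)
    finally have "card N * (p ^ s * card (rcosets N)) = card N * (p ^ s * (p ^ s * h))"
      by (simp add: mult_ac)
    moreover have "card N > 0"
      using card_gt_0_iff[of N] subgroup.one_closed[OF sN] finite_subset[OF N.subset fin] by blast
    ultimately show ?thesis using p1 by (simp add: Coset.order_def FactGroup_def)
  qed
  obtain j where j: "[int p ^ j = - 1] (mod int (largest_divisor_without p (group_exponent (G Mod U))))"
    using sc by (auto simp: self_conjugate_def)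
  have "cyclic_sylow (G Mod N) p s h j (N #> t)"
  proof unfold_locales
    show "prime p" "0 < s" "coprime p h" "Coset.order (G Mod N) = p ^ s * h" by fact+
    show "N #> t \<in> carrier (G Mod N)" using tG by (simp add: carrier_FactGroup)
    show "(N #> t) [^]\<^bsub>G Mod N\<^esub> (p ^ s) = \<one>\<^bsub>G Mod N\<^esub>"
      using N_iff[OF tG] exp[OF t(1)] by simp
    show "(N #> t) [^]\<^bsub>G Mod N\<^esub> (p ^ (s - 1)) \<noteq> \<one>\<^bsub>G Mod N\<^esub>"
    proof
      assume "(N #> t) [^]\<^bsub>G Mod N\<^esub> (p ^ (s - 1)) = \<one>\<^bsub>G Mod N\<^esub>"
      hence "t [^] (p ^ (s - 1)) \<in> N" using N_iff[OF tG] by simp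
      \<comment> \<open>Such a factorisation puts \<open>u\<close> into \<open>U \<inter> P\<close>,
        so the power of \<open>t\<close> would lie in \<open>W\<close>, contrary to the choice of
        \<open>\<chi>\<close>.\<close>
      then obtain u w where uw: "u \<in> U" "w \<in> W" "t [^] (p ^ (s - 1)) = u \<otimes> w"
        by (auto simp: N_def set_mult_def)
      have wP: "w \<in> P" using uw by (simp add: W_def)
      have "u = t [^] (p ^ (s - 1)) \<otimes> inv w"
        using uw wP tG U.subset P.subset by (auto simp: m_assoc)
      hence "u \<in> P" using TP wP by simp
      hence "u = \<one>" using U(2) uw by auto
      hence "t [^] (p ^ (s - 1)) = w" using uw wP P.subset by auto
      thus False using \<chi>(2) uw by (simp add: W_def)
    qed
  next
    fix x assume "x \<in> carrier (G Mod N)"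
    then obtain y where y: "y \<in> carrier G" "x = N #> y" by (auto simp: carrier_FactGroup)
    interpret QU: finite_comm_group "G Mod U" using U(1) by (rule quotient_finite_comm_group)
    interpret NU: normal U G using U(1) by (rule subgroup_imp_normal)
    define n where "n = group_exponent (G Mod U)"
    have "Coset.order (G Mod U) > 0 \<and>
        (\<forall>x\<in>carrier (G Mod U). x [^]\<^bsub>G Mod U\<^esub> Coset.order (G Mod U) = \<one>\<^bsub>G Mod U\<^esub>)"
      using QU.order_pos QU.pow_order_eq_1 by blast
    from LeastI[of "\<lambda>n. n > 0 \<and> (\<forall>x\<in>carrier (G Mod U). x [^]\<^bsub>G Mod U\<^esub> n = \<one>\<^bsub>G Mod U\<^esub>)", OF this]
    have n: "n > 0" "\<And>x. x \<in> carrier (G Mod U) \<Longrightarrow> x [^]\<^bsub>G Mod U\<^esub> n = \<one>\<^bsub>G Mod U\<^esub>"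
      unfolding n_def group_exponent_def by auto
    \<comment> \<open>Since \<open>U\<close> is contained in \<open>N\<close>, the exponent of
      \<open>G Mod U\<close> also annihilates \<open>G Mod N\<close>.\<close>
    have "(U #> y) [^]\<^bsub>G Mod U\<^esub> n = U" using n(2)[of "U #> y"] y by (simp add: carrier_FactGroup)
    hence "U #> (y [^] n) = U" using NU.FactGroup_pow[OF y(1), of n] by simp
    hence "y [^] n \<in> U" using coset_join1[OF _ _ U(1), of "y [^] n"] y by simp
    hence "x [^]\<^bsub>G Mod N\<^esub> n = \<one>\<^bsub>G Mod N\<^esub>" using N_iff[OF y(1)] y(2) \<open>U \<subseteq> N\<close> by auto
    hence ord_n: "Q.ord x dvd n" using Q.pow_eq_id \<open>x \<in> carrier (G Mod N)\<close> by simp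
    obtain n' where n': "n = p ^ multiplicity p n * n'" "\<not> p dvd n'"
      using multiplicity_decompose'[of n p] n(1) p1 by auto
    \<comment> \<open>For a prime \<open>p\<close> the modulus in self-conjugacy is the
      \<open>p\<close>-free part of the exponent.\<close>
    have "largest_divisor_without p n = n'"
      unfolding largest_divisor_without_def
    proof (rule Max_eqI)
      have "{t. t dvd n \<and> \<not> p dvd t} \<subseteq> {..n}" using n(1) by (auto dest: dvd_imp_le)
      thus "finite {t. t dvd n \<and> \<not> p dvd t}" by (rule finite_subset) simp
      show "n' \<in> {t. t dvd n \<and> \<not> p dvd t}" using n' by (metis dvd_triv_right mem_Collect_eq)
      fix r assume r: "r \<in> {t. t dvd n \<and> \<not> p dvd t}"
      hence "coprime r (p ^ multiplicity p n)"
        using p(1) by (simp add: prime_imp_coprime coprime_commute)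
      hence "r dvd n'" using r n' by (metis coprime_dvd_mult_right_iff mem_Collect_eq)
      moreover have "n' > 0" using n' n(1) by (metis gr0I mult_0_right)
      ultimately show "r \<le> n'" by (simp add: dvd_imp_le)
    qed
    hence "int n' dvd int p ^ j + 1" using j unfolding n_def[symmetric] by (simp add: cong_iff_dvd_diff)
    hence n'j: "n' dvd p ^ j + 1" by (metis int_dvd_int_iff of_nat_1 of_nat_add of_nat_power)
    define c where "c = p ^ multiplicity p n"
    have "Q.ord x dvd p ^ s * h" using Q.ord_dvd_group_order \<open>x \<in> carrier (G Mod N)\<close> order_Q by metis
    \<comment> \<open>\<open>c\<close> is a power of \<open>p\<close> and \<open>h\<close> is prime
      to \<open>p\<close>, so beside \<open>p ^ s\<close> only \<open>gcd h n'\<close> remains, and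
      \<open>n'\<close> divides \<open>p ^ j + 1\<close>.\<close>
    hence "Q.ord x dvd gcd (p ^ s * h) (c * n')" using ord_n n' by (simp add: c_def)
    also have "gcd (p ^ s * h) (c * n') dvd p ^ s * gcd h (c * n')"
      by (simp add: gcd_mult_distrib_nat)
    also have "gcd h (c * n') = gcd h n'"
      using coprime by (intro gcd_mult_right_left_cancel) (simp add: c_def coprime_commute)
    also have "p ^ s * gcd h n' dvd p ^ s * (p ^ j + 1)"
      using n'j by (intro mult_dvd_mono) (auto intro: dvd_trans)
    finally show "x [^]\<^bsub>G Mod N\<^esub> (p ^ s * (p ^ j + 1)) = \<one>\<^bsub>G Mod N\<^esub>"
      using Q.pow_eq_id \<open>x \<in> carrier (G Mod N)\<close> by simp
  qed
  from that[OF sN tG this cN] s(2) show ?thesis by simp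
qed

end

section \<open>Counting and producing vanishing characters\<close>

context cyclic_sylow
begin

text \<open>\<open>g\<close> has order \<open>p\<close>, so the characters trivial at
  \<open>g\<close> annihilate a subgroup of order \<open>p\<close> and form a fraction 1/p of all.
  Multiplying by \<open>p\<close> avoids division of naturals.\<close>

lemma card_faithful_characters:
  "card {\<chi> \<in> characters G. \<chi> g \<noteq> 1} * p = (p - 1) * Coset.order G"
proof -
  have g: "g \<in> carrier G" using t by simp
  let ?M = "generate G {g}"
  have sM: "subgroup ?M G" using g by (intro generate_is_subgroup) auto
  have "ord g dvd p"
  proof -
    have "p ^ (s - 1) * p = p ^ s" using s by (cases s) (simp_all add: mult.commute)
    hence "g [^] p = \<one>" using t t_pow by (simp add: nat_pow_pow)
    thus ?thesis using g by (simp only: pow_eq_id)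
  qed
  moreover have "ord g \<noteq> 1" using g t_pow' pow_ord_eq_1[OF g] by (metis nat_pow_eone)
  ultimately have "ord g = p" using p unfolding prime_nat_iff by blast
  hence cM: "card ?M = p" using generate_pow_card[OF g] by simp
  have M_eq: "?M = {g [^] i | i :: nat. i \<in> UNIV}"
    using generate_pow_nat[OF g] \<open>ord g = p\<close> p_pos by simp
  have "\<chi> \<in> annihilator ?M \<longleftrightarrow> \<chi> g = 1" if "\<chi> \<in> characters G" for \<chi>
  proof
    assume "\<chi> \<in> annihilator ?M"
    moreover have "g \<in> ?M" by (rule generate.incl) simp
    ultimately show "\<chi> g = 1" by (simp add: annihilator_def)
  next
    assume "\<chi> g = 1"
    hence "\<chi> (g [^] i) = 1" for i :: nat using character_pow[OF that g, of i] by simp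
    hence "\<chi> x = 1" if "x \<in> ?M" for x using that M_eq by auto
    thus "\<chi> \<in> annihilator ?M" using that by (simp add: annihilator_def)
  qed
  hence eq: "{\<chi> \<in> characters G. \<chi> g \<noteq> 1} = characters G - annihilator ?M"
    by (auto simp: annihilator_def)
  have "annihilator {\<one>} = characters G" by (auto simp: annihilator_def character_one)
  hence cG: "card (characters G) = Coset.order G" using card_annihilator[OF triv_subgroup] by simp
  have "card {\<chi> \<in> characters G. \<chi> g \<noteq> 1} = card (characters G) - card (annihilator ?M)"
    unfolding eq by (rule card_Diff_subset[OF finite_annihilator]) (auto simp: annihilator_def)
  hence "card {\<chi> \<in> characters G. \<chi> g \<noteq> 1} * p = Coset.order G * p - card (annihilator ?M) * card ?M"
    unfolding cM by (simp only: cG diff_mult_distrib)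
  also have "\<dots> = (p - 1) * Coset.order G"
    unfolding card_annihilator[OF sM] by (simp only: diff_mult_distrib mult_1 mult.commute[of _ p])
  finally show ?thesis .
qed

end

context finite_comm_group
begin

lemma inj_on_lift: "inj_on (lift N) (characters (G Mod N))"
proof (rule inj_onI)
  fix \<chi> \<psi> assume *: "\<chi> \<in> characters (G Mod N)" "\<psi> \<in> characters (G Mod N)" "lift N \<chi> = lift N \<psi>"
  have "\<chi> (N #> x) = \<psi> (N #> x)" if "x \<in> carrier G" for x
    using fun_cong[OF *(3), of x] that by (simp add: lift_def)
  hence "\<And>C. C \<in> carrier (G Mod N) \<Longrightarrow> \<chi> C = \<psi> C" by (auto simp: carrier_FactGroup)
  thus "\<chi> = \<psi>" using * by (auto simp: characters_def intro: extensionalityI)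
qed

text \<open>A lifted character is constant on cosets of \<open>N\<close>, so its sum over
  \<open>A\<close> is a character sum on the quotient with the coset counts of \<open>A\<close> as
  coefficients.\<close>

lemma sum_lift:
  assumes N: "subgroup N G" and A: "A \<subseteq> carrier G"
  shows "(\<Sum>x\<in>A. lift N \<chi> x) = (\<Sum>C\<in>carrier (G Mod N). of_int (int (card (A \<inter> C))) * \<chi> C)"
proof -
  have finA: "finite A" using A fin by (rule finite_subset)
  have eq: "{x \<in> A. N #> x = C} = A \<inter> C" if C: "C \<in> carrier (G Mod N)" for C
  proof -
    obtain y where y: "y \<in> carrier G" "C = N #> y" using C by (auto simp: carrier_FactGroup)
    have "N #> x = C \<longleftrightarrow> x \<in> C" if "x \<in> A" for x
    proof
      show "x \<in> C" if "N #> x = C" using rcos_self[OF _ N] that A \<open>x \<in> A\<close> by blast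
      show "N #> x = C" if "x \<in> C" using repr_independence[OF _ y(1) N] y(2) that by simp
    qed
    thus ?thesis by auto
  qed
  have "(\<Sum>x\<in>{x \<in> A. N #> x = C}. lift N \<chi> x) = (\<Sum>x\<in>{x \<in> A. N #> x = C}. \<chi> C)"
    for C using A by (intro sum.cong) (auto simp: lift_def)
  moreover have "(\<Sum>x\<in>A. lift N \<chi> x) = (\<Sum>C\<in>carrier (G Mod N). \<Sum>x\<in>{x \<in> A. N #> x = C}. lift N \<chi> x)"
    using A fin finA by (intro sum.group[symmetric]) (auto simp: carrier_FactGroup)
  ultimately have "(\<Sum>x\<in>A. lift N \<chi> x) = (\<Sum>C\<in>carrier (G Mod N). \<Sum>x\<in>{x \<in> A. N #> x = C}. \<chi> C)"
    by simp
  also have "\<dots> = (\<Sum>C\<in>carrier (G Mod N). of_int (int (card (A \<inter> C))) * \<chi> C)"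
    using eq by (intro sum.cong) simp_all
  finally show ?thesis .
qed

text \<open>The coset counts lie between 0 and \<open>card N\<close>, which is less than
  \<open>p ^ d\<close>. Counts at cosets differing by the element of order \<open>p\<close> are
  congruent modulo \<open>p ^ d\<close>, hence equal, and invariance makes the character sum
  vanish.\<close>

lemma char_extend_lift_eq_0:
  assumes N: "subgroup N G" and t: "t \<in> carrier G"
    and cs: "cyclic_sylow (G Mod N) p s h j (N #> t)"
    and A: "A \<subseteq> carrier G" and lt: "card N < p ^ d"
    and div: "\<forall>\<chi>\<in>characters G - {principal_character G}.
         alg_int_cong (of_real ((cmod (char_extend \<chi> (gr_set A)))\<^sup>2)) 0 (of_nat (p ^ (2 * d)))"
    and \<chi>: "\<chi> \<in> characters (G Mod N)" "\<chi> ((N #> t) [^]\<^bsub>G Mod N\<^esub> (p ^ (s - 1))) \<noteq> 1"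
  shows "lift N \<chi> \<in> nonprincipal_zeros G A"
proof -
  interpret Q: cyclic_sylow "G Mod N" p s h j "N #> t" by (rule cs)
  interpret N: normal N G using N by (rule subgroup_imp_normal)
  define a where "a = (\<lambda>C. int (card (A \<inter> C)))"
  have sum: "char_extend (lift N \<psi>) (gr_set A) = Q.charsum \<psi> a" for \<psi>
    unfolding char_extend_gr_set sum_lift[OF N A] Q.charsum_def a_def ..
  have nonprincipal: "lift N \<psi> \<noteq> principal_character G"
    if "\<psi> ((N #> t) [^]\<^bsub>G Mod N\<^esub> (p ^ (s - 1))) \<noteq> 1" for \<psi>
  proof
    assume *: "lift N \<psi> = principal_character G"
    have "lift N \<psi> (t [^] (p ^ (s - 1))) \<noteq> 1"
      using that t N.FactGroup_pow[OF t] by (simp add: lift_def)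
    thus False using t by (simp add: * principal_character_def)
  qed
  have bound: "0 \<le> a C \<and> a C \<le> int (card N)" if "C \<in> carrier (G Mod N)" for C
  proof -
    have C: "C \<in> rcosets N" using that by (simp add: FactGroup_def)
    hence "card C = card N"
      using card_cosets_equal[OF C N.subset] by (metis bij_betw_same_card)
    moreover have "finite C"
      using C fin r_coset_subset_G[OF N.subset] finite_subset unfolding RCOSETS_def by blast
    moreover from this have "card (A \<inter> C) \<le> card C" by (intro card_mono) auto
    ultimately show ?thesis unfolding a_def by simp
  qed
  have "of_nat (p ^ (2 * d)) advd Q.charsum \<psi> a * cnj (Q.charsum \<psi> a)"
    if "\<psi> \<in> characters (G Mod N)" "\<psi> ((N #> t) [^]\<^bsub>G Mod N\<^esub> (p ^ (s - 1))) \<noteq> 1" for \<psi>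
    using div lift_mem_characters[OF N that(1)] nonprincipal[of \<psi>] that(2)
    unfolding alg_int_cong_def alg_dvd_def complex_norm_square sum[symmetric] by auto
  note shift = Q.cong_shift[OF this]
  have "Q.charsum \<chi> a = 0"
  proof (rule Q.charsum_invariant[OF \<chi>(1) _ \<chi>(2)])
    show g: "(N #> t) [^]\<^bsub>G Mod N\<^esub> (p ^ (s - 1)) \<in> carrier (G Mod N)"
      using Q.t by simp
    fix C assume C: "C \<in> carrier (G Mod N)"
    let ?C = "C \<otimes>\<^bsub>G Mod N\<^esub> (N #> t) [^]\<^bsub>G Mod N\<^esub> (p ^ (s - 1))"
    have "?C \<in> carrier (G Mod N)" using C g by (rule Q.m_closed)
    hence "\<bar>a C - a ?C\<bar> \<le> int (card N)" using bound[OF C] bound[of ?C] by linarith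
    also have "\<dots> < int (p ^ d)" using lt by simp
    finally have "a C - a ?C = 0" using shift[OF _ _ C] by (metis dvd_imp_le_int linorder_not_less abs_of_nat)
    thus "a ?C = a C" by simp
  qed
  thus ?thesis
    using lift_mem_characters[OF N \<chi>(1)] nonprincipal[of \<chi>] \<chi>(2) sum[of \<chi>]
    by (simp add: nonprincipal_zeros_def)
qed

end

section \<open>The exponent bounds\<close>

theorem theorem5p18:
  fixes G (structure) and D :: "nat \<Rightarrow> 'a set" and U P :: "'a set"
    and v m k l p d :: nat
  assumes "comm_group G" and "finite (carrier G)"
    and "SEDF G v m k l D"
    and "prime p" and "p dvd v"
    and "sylow_subgroup p P G"
    and "subgroup U G" and "U \<inter> P = {\<one>}"
    and "self_conjugate p (group_exponent (G Mod U))"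
  shows
    "((\<forall>\<chi>\<in>characters G - {principal_character G}.
         alg_int_cong (of_real ((cmod (char_extend \<chi> (gr_set (\<Union>i\<in>{1..m}. D i))))\<^sup>2)) 0
           (of_nat (p ^ (2 * d)))) \<longrightarrow>
       real (group_exponent (G\<lparr>carrier := P\<rparr>)) \<le>
         max (real (card U) / real p ^ d * real (card P))
             (real p * real (card (nonprincipal_zeros G (\<Union>i\<in>{1..m}. D i))) * real (card U)
                / ((real p - 1) * real v) * real (card P))) \<and>
     ((\<forall>\<chi>\<in>characters G - {principal_character G}.
         alg_int_cong (of_real ((cmod (char_extend \<chi> (gr_set (D 1))))\<^sup>2)) 0
           (of_nat (p ^ (2 * d)))) \<longrightarrow>
       real (group_exponent (G\<lparr>carrier := P\<rparr>)) \<le>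
         real (card U) / real p ^ d * real (card P))"
proof -
  interpret finite_comm_group G
    using assms(1,2) by (simp add: finite_comm_group_def finite_comm_group_axioms_def)
  have v: "Coset.order G = v" and m: "1 \<in> {1..m}" and D: "\<And>i. i \<in> {1..m} \<Longrightarrow> D i \<subseteq> carrier G"
    using assms(3) unfolding SEDF_def by auto
  obtain N s h j t where N: "subgroup N G" and t: "t \<in> carrier G"
    and cs: "cyclic_sylow (G Mod N) p s h j (N #> t)"
    and cN: "card N * p ^ s = card U * card P"
    and e: "p ^ s = group_exponent (G\<lparr>carrier := P\<rparr>)"
    using ex_cyclic_sylow_quotient[OF assms(4) _ assms(6-9)] assms(5) v by metis
  interpret Q: cyclic_sylow "G Mod N" p s h j "N #> t" by (rule cs)
  have p1: "p > 1" using assms(4) by (rule prime_gt_1_nat)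
  have orderN: "Coset.order (G Mod N) * card N = v"
    using lagrange[OF N] v by (simp add: Coset.order_def FactGroup_def)
  have v0: "v > 0" using order_pos v by simp
  have cN': "real (card N) * real (p ^ s) = real (card U) * real (card P)"
    using cN by (metis of_nat_mult)
  \<comment> \<open>The case \<open>p ^ d \<le> card N\<close>: multiplying by \<open>p ^ s\<close>
    and using \<open>cN'\<close> gives the first bound.\<close>
  have small: "real (p ^ s) \<le> real (card U) / real p ^ d * real (card P)" if "\<not> card N < p ^ d"
  proof -
    have "real p ^ d * real (p ^ s) \<le> real (card N) * real (p ^ s)"
      using that by (intro mult_right_mono) (auto simp flip: of_nat_power)
    thus ?thesis unfolding cN' using p1 by (simp add: field_simps)
  qed
  let ?F = "{\<chi> \<in> characters (G Mod N). \<chi> ((N #> t) [^]\<^bsub>G Mod N\<^esub> (p ^ (s - 1))) \<noteq> 1}"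
  show ?thesis
  proof (intro conjI impI)
    let ?A = "\<Union>i\<in>{1..m}. D i"
    let ?Z = "nonprincipal_zeros G ?A"
    assume div: "\<forall>\<chi>\<in>characters G - {principal_character G}.
         alg_int_cong (of_real ((cmod (char_extend \<chi> (gr_set ?A)))\<^sup>2)) 0 (of_nat (p ^ (2 * d)))"
    show "real (group_exponent (G\<lparr>carrier := P\<rparr>)) \<le>
         max (real (card U) / real p ^ d * real (card P))
             (real p * real (card ?Z) * real (card U) / ((real p - 1) * real v) * real (card P))"
    proof (cases "card N < p ^ d")
      case True
      have A: "?A \<subseteq> carrier G" using D by blast
      \<comment> \<open>All characters of the quotient nontrivial at the element of order
        \<open>p\<close> lift to zeros on the union; lifting is injective, so their number bounds
        \<open>card ?Z\<close> from below.\<close>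
      have sub: "lift N ` ?F \<subseteq> ?Z"
        using char_extend_lift_eq_0[OF N t cs A True div] by blast
      have fin_Z: "finite ?Z" using finite_characters by (simp add: nonprincipal_zeros_def)
      have inj: "inj_on (lift N) ?F" by (rule inj_on_subset[OF inj_on_lift]) blast
      have "card ?F \<le> card ?Z" using card_mono[OF fin_Z sub] unfolding card_image[OF inj] .
      hence "card ?F * p \<le> card ?Z * p" by (rule mult_le_mono1)
      hence "(p - 1) * Coset.order (G Mod N) \<le> card ?Z * p"
        unfolding Q.card_faithful_characters .
      hence "(p - 1) * Coset.order (G Mod N) * card N \<le> card ?Z * p * card N" by (rule mult_le_mono1)
      hence "(p - 1) * v \<le> card ?Z * p * card N" unfolding mult.assoc[of "p - 1"] orderN .
      hence "real ((p - 1) * v) \<le> real (card ?Z * p * card N)" by (simp only: of_nat_le_iff)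
      hence "(real p - 1) * real v \<le> real p * real (card ?Z) * real (card N)"
        using p1 by (simp add: of_nat_diff mult_ac)
      hence "(real p - 1) * real v * real (p ^ s) \<le> real p * real (card ?Z) * real (card N) * real (p ^ s)"
        by (intro mult_right_mono) auto
      also have "\<dots> = real p * real (card ?Z) * real (card U) * real (card P)"
        using cN' by (simp only: mult.assoc)
      finally have "real (p ^ s) \<le> real p * real (card ?Z) * real (card U) / ((real p - 1) * real v) * real (card P)"
        using p1 v0 by (simp add: field_simps)
      thus ?thesis using e by (simp add: le_max_iff_disj)
    next
      case False
      thus ?thesis using small e by (simp add: le_max_iff_disj)
    qed
  next
    assume div: "\<forall>\<chi>\<in>characters G - {principal_character G}.
         alg_int_cong (of_real ((cmod (char_extend \<chi> (gr_set (D 1))))\<^sup>2)) 0 (of_nat (p ^ (2 * d)))"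
    \<comment> \<open>Otherwise some lifted nonprincipal character would vanish on
      \<open>D 1\<close>, which the SEDF equation excludes.\<close>
    have "\<not> card N < p ^ d"
    proof
      assume lt: "card N < p ^ d"
      obtain \<chi> where \<chi>: "\<chi> \<in> characters (G Mod N)" "\<chi> ((N #> t) [^]\<^bsub>G Mod N\<^esub> (p ^ (s - 1))) \<noteq> 1"
        using Q.ex_faithful_character by blast
      have "lift N \<chi> \<in> nonprincipal_zeros G (D 1)"
        by (rule char_extend_lift_eq_0[OF N t cs D[OF m] lt div \<chi>])
      thus False using SEDF_character_neq_0[OF assms(3) _ _ m] by (auto simp: nonprincipal_zeros_def)
    qed
    thus "real (group_exponent (G\<lparr>carrier := P\<rparr>)) \<le> real (card U) / real p ^ d * real (card P)"
      using small e by simp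
  qed
qed

end
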